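(* Let $K \subset \mathbb{R}^2$ be a centrally symmetric convex body with centre of symmetry $O$. Let $X$ be a uniformly distributed random point in $K$ and $Y$ a uniformly distributed random point on $\partial K$. Then for every real $n > 0$, $$\mathbb{E}|OY|^n > \mathbb{E}|OX|^n.$$
   Context: A convex body is a convex compact set with non-empty interior. "Uniform in $K$" is with respect to Lebesgue measure; "uniform on $\partial K$" is with respect to arc length. $|AB|$ denotes the Euclidean distance between points $A$ and $B$. *)

theory Defs
  imports "HOL-Probability.Probability"
begin

definition convex_body :: "'a::euclidean_space set \<Rightarrow> bool" where
  "convex_body K \<longleftrightarrow> convex K \<and> compact K \<and> interior K \<noteq> {}"

definition centrally_symmetric_about :: "'a::real_vector \<Rightarrow> 'a set \<Rightarrow> bool" where
  "centrally_symmetric_about c K \<longleftrightarrow> (\<forall>x\<in>K. 2 *\<^sub>R c - x \<in> K)"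

(* Supremum of the lengths of inscribed polygonal lines; infinite if the curve is not rectifiable. *)
definition curve_length :: "(real \<Rightarrow> 'a::metric_space) \<Rightarrow> real \<Rightarrow> real \<Rightarrow> ennreal" where
  "curve_length \<gamma> a b =
     (SUP ts\<in>{ts. sorted ts \<and> set ts \<subseteq> {a..b}}.
        \<Sum>i<length ts - 1. ennreal (dist (\<gamma> (ts ! i)) (\<gamma> (ts ! Suc i))))"

definition arc_length_parametrization ::
    "(real \<Rightarrow> 'a::metric_space) \<Rightarrow> real \<Rightarrow> 'a set \<Rightarrow> bool" where
  "arc_length_parametrization \<gamma> L C \<longleftrightarrow>
     0 < L \<and> continuous_on {0..L} \<gamma> \<and> \<gamma> L = \<gamma> 0 \<and> inj_on \<gamma> {0..<L} \<and> \<gamma> ` {0..L} = C \<and>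
     (\<forall>s t. 0 \<le> s \<and> s \<le> t \<and> t \<le> L \<longrightarrow> curve_length \<gamma> s t = ennreal (t - s))"

(* \<sigma> is the arc length measure of the rectifiable simple closed curve C. It does not depend on the
   parametrization: two of them differ by a shift of the starting point and the orientation. *)
definition arc_length_measure_on :: "'a::metric_space set \<Rightarrow> 'a measure \<Rightarrow> bool" where
  "arc_length_measure_on C \<sigma> \<longleftrightarrow>
     (\<exists>\<gamma> L. arc_length_parametrization \<gamma> L C \<and>
            \<sigma> = distr (restrict_space lborel {0..L}) borel \<gamma>)"

definition uniform_wrt_lebesgue :: "'w measure \<Rightarrow> ('w \<Rightarrow> 'a::euclidean_space) \<Rightarrow> 'a set \<Rightarrow> bool" where
  "uniform_wrt_lebesgue M X K \<longleftrightarrow>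
     X \<in> borel_measurable M \<and> distr M borel X = uniform_measure lborel K"

definition uniform_wrt_arc_length :: "'w measure \<Rightarrow> ('w \<Rightarrow> 'a::metric_space) \<Rightarrow> 'a set \<Rightarrow> bool" where
  "uniform_wrt_arc_length M Y C \<longleftrightarrow>
     Y \<in> borel_measurable M \<and>
     (\<exists>\<sigma>. arc_length_measure_on C \<sigma> \<and> distr M borel Y = uniform_measure \<sigma> C)"

end

theory Submission
  imports Defs
begin

text \<open>With centre \<open>0\<close>, the distance of \<open>Y\<close> to the centre stochastically dominates that of \<open>X\<close>: for
  every \<open>t > 0\<close>, the length of \<open>\<partial>K\<close> inside the disc \<open>B\<^sub>t\<close> times \<open>|K \<setminus> B\<^sub>t|\<close> is at most the length
  of \<open>\<partial>K\<close> outside \<open>B\<^sub>t\<close> times \<open>|K \<inter> B\<^sub>t|\<close>. An arc of \<open>\<partial>K\<close> outside \<open>B\<^sub>t\<close> joins two points \<open>Q\<close>, \<open>P\<close> of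
  the circle; together with \<open>-Q\<close>, \<open>-P\<close> they form a rectangle with sides \<open>2a\<close>, \<open>2b\<close>, where
  \<open>2b = |PQ|\<close>. By convexity the cap cut off by the arc lies in the strip of width \<open>2b\<close> through
  \<open>P\<close> and \<open>Q\<close>, so its area is at most \<open>b\<close> times the length of the arc. The part of \<open>\<partial>K\<close> inside
  \<open>B\<^sub>t\<close> consists of pieces of the graph of a concave function on \<open>[-a, a]\<close> and of its mirror image;
  it leaves the corners at slope at most \<open>a/b\<close>, so if \<open>M\<close> is the largest height of \<open>K \<inter> B\<^sub>t\<close>, each
  half has length at most \<open>2a + (a/b)(M - b)\<close>, while \<open>K \<inter> B\<^sub>t\<close> contains a hexagon of area
  \<open>4ab + 2a(M - b)\<close>. Hence \<open>b\<close> times the inner length is at most \<open>|K \<inter> B\<^sub>t|\<close>, and the claim follows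
  by summing over the outer arcs. The dominance is strict for \<open>t\<close> below the inradius.\<close>

section \<open>Orthonormal frames of the plane\<close>

lemma exists_2: "(\<exists>i::2. P i) \<longleftrightarrow> P 1 \<or> P 2"
  by (metis exhaust_2)

locale orthonormal_frame =
  fixes u v :: "real ^ 2"
  assumes norm_u: "norm u = 1" and norm_v: "norm v = 1" and orth: "u \<bullet> v = 0"
begin

lemma uu [simp]: "u \<bullet> u = 1" and vv [simp]: "v \<bullet> v = 1"
  and uv [simp]: "u \<bullet> v = 0" and vu [simp]: "v \<bullet> u = 0"
  using norm_u norm_v orth by (simp_all add: norm_eq_1 inner_commute)

definition pt :: "real \<Rightarrow> real \<Rightarrow> real ^ 2" where
  "pt x y = x *\<^sub>R u + y *\<^sub>R v"

lemma pt_u [simp]: "pt x y \<bullet> u = x" and pt_v [simp]: "pt x y \<bullet> v = y"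
  by (simp_all add: pt_def inner_add_left)

text \<open>Two orthonormal vectors span the plane: \<open>v\<close> is \<open>u\<close> turned by a
  right angle, times the determinant \<open>d\<close> of the frame, and \<open>d\<close> squares to
  1.\<close>

lemma expand: "x = pt (x \<bullet> u) (x \<bullet> v)"
proof -
  have 1: "u$1 * u$1 + u$2 * u$2 = 1" "v$1 * v$1 + v$2 * v$2 = 1" "u$1 * v$1 + u$2 * v$2 = 0"
    using uu vv uv by (simp_all only: inner_vec_def sum_2 inner_real_def)
  define d where "d = u$1 * v$2 - u$2 * v$1"
  have "d * d = 1" unfolding d_def using 1 by algebra
  then have v1: "v$1 = - d * u$2" and v2: "v$2 = d * u$1"
    unfolding d_def using 1 by algebra+
  have "x$1 = (x$1 * u$1 + x$2 * u$2) * u$1 + (x$1 * v$1 + x$2 * v$2) * v$1"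
    "x$2 = (x$1 * u$1 + x$2 * u$2) * u$2 + (x$1 * v$1 + x$2 * v$2) * v$2"
    unfolding v1 v2 using 1(1) \<open>d * d = 1\<close> by algebra+
  then show ?thesis
    by (simp add: pt_def vec_eq_iff forall_2 inner_vec_def sum_2)
qed

lemma eq_iff: "x = y \<longleftrightarrow> x \<bullet> u = y \<bullet> u \<and> x \<bullet> v = y \<bullet> v"
  using expand[of x] expand[of y] by metis

lemma norm_sq: "(norm x)\<^sup>2 = (x \<bullet> u)\<^sup>2 + (x \<bullet> v)\<^sup>2"
proof -
  have "x \<bullet> x = x \<bullet> pt (x \<bullet> u) (x \<bullet> v)"
    using expand[of x] by simp
  also have "\<dots> = (x \<bullet> u)\<^sup>2 + (x \<bullet> v)\<^sup>2"
    unfolding pt_def by (simp add: inner_add_right power2_eq_square)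
  finally show ?thesis by (simp add: power2_norm_eq_inner)
qed

text \<open>The coordinate map is a linear isometry, so areas of boxes in the frame reduce to those
  of standard boxes by \<open>measure_orthogonal_image\<close>.\<close>

lemma linear_coords: "orthogonal_transformation (\<lambda>x :: real^2. pt (x$1) (x$2))"
proof -
  have "linear (\<lambda>x :: real^2. pt (x$1) (x$2))"
    by (auto simp: linear_iff pt_def algebra_simps)
  moreover have "norm (pt (x$1) (x$2)) = norm x" for x :: "real^2"
  proof -
    have "(norm x)\<^sup>2 = (x$1)\<^sup>2 + (x$2)\<^sup>2"
      unfolding power2_norm_eq_inner by (simp add: inner_vec_def sum_2 power2_eq_square)
    then have "(norm (pt (x$1) (x$2)))\<^sup>2 = (norm x)\<^sup>2"
      using norm_sq[of "pt (x$1) (x$2)"] by simp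
    then show ?thesis by (simp add: power2_eq_iff_nonneg)
  qed
  ultimately show ?thesis by (simp add: orthogonal_transformation)
qed

lemma coords_image:
  "(\<lambda>x :: real^2. pt (x$1) (x$2)) ` {x. P (x$1) (x$2)} = {x. P (x \<bullet> u) (x \<bullet> v)}"
proof (intro equalityI subsetI)
  fix x assume "x \<in> {x. P (x \<bullet> u) (x \<bullet> v)}"
  then show "x \<in> (\<lambda>x :: real^2. pt (x$1) (x$2)) ` {x. P (x$1) (x$2)}"
    using expand[of x]
    by (intro image_eqI[of _ _ "vector [x \<bullet> u, x \<bullet> v]"]) (auto simp: vector_2)
qed auto

lemma measure_rectangle:
  assumes "p \<le> q" "r \<le> s"
  shows "measure lebesgue {x. p \<le> x \<bullet> u \<and> x \<bullet> u \<le> q \<and> r \<le> x \<bullet> v \<and> x \<bullet> v \<le> s} = (q - p) * (s - r)"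
    (is "measure _ ?S = _")
proof -
  have "cbox (vector [p, r]) (vector [q, s])
      = {x :: real^2. p \<le> x$1 \<and> x$1 \<le> q \<and> r \<le> x$2 \<and> x$2 \<le> s}"
    by (auto simp: mem_box_cart forall_2 vector_2)
  note image = this
  have "measure lebesgue ?S = measure lebesgue (cbox (vector [p, r]) (vector [q, s]) :: (real^2) set)"
    unfolding coords_image[of "\<lambda>x y. p \<le> x \<and> x \<le> q \<and> r \<le> y \<and> y \<le> s", symmetric] image[symmetric]
    using measure_orthogonal_image[OF linear_coords lmeasurable_cbox, of "vector [p, r]" "vector [q, s]"] by simp
  also have "\<dots> = (q - p) * (s - r)"
    using assms by (simp add: content_cbox_if_cart interval_eq_empty_cart forall_2 exists_2 UNIV_2 vector_2 not_less)
  finally show ?thesis .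
qed

lemma measure_rectangle_open:
  assumes "0 \<le> a" "0 \<le> b"
  shows "measure lebesgue {x. \<bar>x \<bullet> u\<bar> < a \<and> \<bar>x \<bullet> v\<bar> < b} = 4 * a * b"
    (is "measure _ ?S = _")
proof -
  have "box (vector [-a, -b]) (vector [a, b]) = {x :: real^2. \<bar>x$1\<bar> < a \<and> \<bar>x$2\<bar> < b}"
    by (auto simp: mem_box_cart forall_2 vector_2)
  note image = this
  have "measure lebesgue ?S = measure lebesgue (box (vector [-a, -b]) (vector [a, b]) :: (real^2) set)"
    unfolding coords_image[of "\<lambda>x y. \<bar>x\<bar> < a \<and> \<bar>y\<bar> < b", symmetric] image[symmetric]
    using measure_orthogonal_image[OF linear_coords lmeasurable_box, of "vector [-a, -b]" "vector [a, b]"] by simp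
  also have "\<dots> = measure lborel (cbox (vector [-a, -b]) (vector [a, b]) :: (real^2) set)"
    by (simp add: measure_lborel_box_eq measure_lborel_cbox_eq)
  also have "\<dots> = 4 * a * b"
    using assms by (simp add: content_cbox_if_cart interval_eq_empty_cart forall_2 exists_2 UNIV_2 vector_2 not_less)
  finally show ?thesis .
qed

lemma frame_det: "(u$1 * v$2 - u$2 * v$1)\<^sup>2 = 1"
proof -
  have 1: "u$1 * u$1 + u$2 * u$2 = 1" "v$1 * v$1 + v$2 * v$2 = 1" "u$1 * v$1 + u$2 * v$2 = 0"
    using uu vv uv by (simp_all only: inner_vec_def sum_2 inner_real_def)
  then show ?thesis by algebra
qed

text \<open>Passing from frame to standard coordinates multiplies the signed area by the determinant
  of the frame, which is 1 or -1.\<close>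

lemma measure_triangle:
  "measure lborel (convex hull {pt p r, pt q r, pt x s}) = \<bar>(q - p) * (s - r)\<bar> / 2"
proof -
  have "\<bar>u$1 * v$2 - u$2 * v$1\<bar> = 1"
    using frame_det by (simp add: power2_eq_1_iff abs_if) argo
  moreover have "\<bar>(pt x s $ 1 - pt p r $ 1) * (pt q r $ 2 - pt p r $ 2) - (pt q r $ 1 - pt p r $ 1) * (pt x s $ 2 - pt p r $ 2)\<bar>
    = \<bar>(q - p) * (s - r) * (u$1 * v$2 - u$2 * v$1)\<bar>"
    by (subst abs_minus_cancel[symmetric], rule arg_cong[of _ _ abs]) (simp add: pt_def algebra_simps)
  ultimately show ?thesis
    unfolding content_triangle by (simp add: abs_mult)
qed

lemma pt_minus [simp]: "- pt x y = pt (-x) (-y)"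
  by (simp add: pt_def)

lemma convex_comb_pt: "(1 - \<mu>) *\<^sub>R pt x y + \<mu> *\<^sub>R pt x' y' = pt ((1 - \<mu>) * x + \<mu> * x') ((1 - \<mu>) * y + \<mu> * y')"
  by (simp add: pt_def algebra_simps)

text \<open>Interpolation in two steps: first along the two sides at heights \<open>b\<close> and
  \<open>-b\<close>, then vertically between the two points found there.\<close>

lemma rectangle_subset_convex:
  assumes "convex S" and corners: "pt a b \<in> S" "pt (-a) b \<in> S" "pt a (-b) \<in> S" "pt (-a) (-b) \<in> S"
    and "0 < a" "0 < b" and z: "\<bar>z \<bullet> u\<bar> \<le> a" "\<bar>z \<bullet> v\<bar> \<le> b"
  shows "z \<in> S"
proof -
  define \<mu> where "\<mu> = (z \<bullet> u + a) / (2 * a)"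
  define \<nu> where "\<nu> = (z \<bullet> v + b) / (2 * b)"
  have \<mu>: "0 \<le> \<mu>" "\<mu> \<le> 1" "(1 - \<mu>) * (- a) + \<mu> * a = z \<bullet> u"
    and \<nu>: "0 \<le> \<nu>" "\<nu> \<le> 1" "(1 - \<nu>) * (- b) + \<nu> * b = z \<bullet> v"
    using assms by (auto simp: \<mu>_def \<nu>_def field_simps)
  have "pt (z \<bullet> u) y \<in> S" if "y = b \<or> y = -b" for y
  proof -
    have "pt ((1 - \<mu>) * (- a) + \<mu> * a) ((1 - \<mu>) * y + \<mu> * y) \<in> S"
      unfolding convex_comb_pt[symmetric] using that corners \<mu>
      by (intro convexD[OF \<open>convex S\<close>]) auto
    then show ?thesis using \<mu>(3) by (simp add: algebra_simps)
  qed
  then have "pt ((1 - \<nu>) * (z \<bullet> u) + \<nu> * (z \<bullet> u)) ((1 - \<nu>) * (- b) + \<nu> * b) \<in> S"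
    unfolding convex_comb_pt[symmetric] using \<nu>
    by (intro convexD[OF \<open>convex S\<close>]) auto
  then have "pt (z \<bullet> u) (z \<bullet> v) \<in> S" using \<nu>(3) by (simp add: algebra_simps)
  then show ?thesis using expand[of z] by simp
qed

text \<open>\<open>S\<close> contains the rectangle and two triangles on its sides at heights
  \<open>b\<close> and \<open>-b\<close>, with apexes \<open>pt x M\<close> and
  \<open>pt (-x) (-M)\<close>. Each triangle has base \<open>2 * a\<close> and height
  \<open>M - b\<close>, whatever \<open>x\<close> is.\<close>

lemma hexagon_area:
  assumes S: "convex S" "compact S"
    and corners: "pt a b \<in> S" "pt (-a) b \<in> S" "pt a (-b) \<in> S" "pt (-a) (-b) \<in> S"
    and apex: "pt x M \<in> S" "pt (-x) (-M) \<in> S" and "0 < a" "0 < b" "b \<le> M"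
  shows "4 * a * b + 2 * a * (M - b) \<le> measure lborel S"
proof -
  \<comment> \<open>The open rectangle, so that it is disjoint from the closed triangles on its
    sides.\<close>
  let ?R = "{x. \<bar>x \<bullet> u\<bar> < a \<and> \<bar>x \<bullet> v\<bar> < b}"
  let ?T = "convex hull {pt (-a) b, pt a b, pt x M}"
  let ?T' = "convex hull {pt (-a) (-b), pt a (-b), pt (-x) (-M)}"
  have cl: "?R = {x. x \<bullet> u < a} \<inter> {x. -a < x \<bullet> u} \<inter> {x. x \<bullet> v < b} \<inter> {x. -b < x \<bullet> v}"
    by auto
  have "open ?R" unfolding cl by (intro open_Int open_Collect_less continuous_intros)
  have RS: "?R \<subseteq> S"
    using rectangle_subset_convex[OF S(1) corners \<open>0 < a\<close> \<open>0 < b\<close>] by auto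
  have TS: "?T \<subseteq> S" "?T' \<subseteq> S"
    using corners apex S(1) by (simp_all add: subset_hull)
  have "?T \<subseteq> {x. b \<le> v \<bullet> x}"
    by (rule hull_minimal, use \<open>b \<le> M\<close> in \<open>simp add: inner_commute[of v]\<close>) (rule convex_halfspace_ge)
  moreover have "?T' \<subseteq> {x. v \<bullet> x \<le> -b}"
    by (rule hull_minimal, use \<open>b \<le> M\<close> in \<open>simp add: inner_commute[of v]\<close>) (rule convex_halfspace_le)
  ultimately have disj: "?R \<inter> ?T = {}" "(?R \<union> ?T) \<inter> ?T' = {}"
    using \<open>0 < b\<close> by (fastforce simp: inner_commute)+
  have compact: "compact ?T" "compact ?T'"
    by (auto intro: finite_imp_compact_convex_hull)
  have meas: "?R \<in> lmeasurable" "?T \<in> lmeasurable" "?T' \<in> lmeasurable" "S \<in> lmeasurable"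
    using \<open>open ?R\<close> RS S(2) compact
    by (auto intro: lmeasurable_compact lmeasurable_open bounded_subset compact_imp_bounded)
  have bor: "?T \<in> sets borel" "?T' \<in> sets borel" "S \<in> sets borel"
    using compact S(2) by (auto intro: borel_compact)
  have un: "measure lebesgue (A \<union> B) = measure lebesgue A + measure lebesgue B"
    if "A \<in> lmeasurable" "B \<in> lmeasurable" "A \<inter> B = {}" for A B :: "(real^2) set"
    using that by (intro measure_Union) (auto simp: fmeasurable_def)
  have "measure lebesgue (?R \<union> ?T \<union> ?T') = measure lebesgue ?R + measure lebesgue ?T + measure lebesgue ?T'"
    using disj meas by (simp only: un fmeasurable.Un)
  also have "\<dots> = 4 * a * b + (2 * a) * (M - b) / 2 + (2 * a) * (M - b) / 2"
  proof -
    have "measure lebesgue ?R = 4 * a * b"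
      using \<open>0 < a\<close> \<open>0 < b\<close> by (intro measure_rectangle_open) auto
    moreover have "measure lebesgue ?T = (2 * a) * (M - b) / 2" "measure lebesgue ?T' = (2 * a) * (M - b) / 2"
      using assms bor by (simp_all add: measure_triangle measure_completion abs_mult)
    ultimately show ?thesis by (simp only:)
  qed
  finally have "4 * a * b + 2 * a * (M - b) = measure lebesgue (?R \<union> ?T \<union> ?T')" by simp
  also have "\<dots> \<le> measure lebesgue S"
    using RS TS meas by (intro measure_mono_fmeasurable) auto
  also have "\<dots> = measure lborel S" using bor by (simp add: measure_completion)
  finally show ?thesis .
qed

end

section \<open>Centrally symmetric convex bodies and inscribed rectangles\<close>

text \<open>The centre is normalised to the origin; \<open>symmetric_body_translate\<close> brings
  the general case into this form.\<close>

locale symmetric_body =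
  fixes K :: "'a::euclidean_space set"
  assumes convex_K: "convex K" and compact_K: "compact K"
    and uminus_K: "x \<in> K \<Longrightarrow> - x \<in> K" and zero_interior: "0 \<in> interior K"
begin

lemma closed_K: "closed K"
  using compact_K by (rule compact_imp_closed)

lemma frontier_K: "z \<in> frontier K \<longleftrightarrow> z \<in> K \<and> z \<notin> interior K"
  using closed_K by (simp add: frontier_def)

lemma scale_interior:
  assumes "x \<in> K" "0 \<le> r" "r < 1"
  shows "r *\<^sub>R x \<in> interior K"
  using mem_interior_closure_convex_shrink[OF convex_K zero_interior, of x "1 - r"] assms closed_K
  by (simp add: algebra_simps)

text \<open>A point of \<open>K\<close> beyond \<open>z\<close> on its ray would make
  \<open>z\<close> a proper shrinking of that point, hence interior.\<close>

lemma frontier_scale_le: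
  assumes "z \<in> frontier K" "r *\<^sub>R z \<in> K"
  shows "r \<le> 1"
proof (rule ccontr)
  assume "\<not> r \<le> 1"
  then have "inverse r *\<^sub>R (r *\<^sub>R z) \<in> interior K"
    using assms by (intro scale_interior) (auto simp: inverse_less_1_iff)
  with \<open>\<not> r \<le> 1\<close> assms(1) show False by (simp add: frontier_K)
qed

lemma uminus_frontier:
  assumes "z \<in> frontier K"
  shows "- z \<in> frontier K"
proof -
  have "uminus ` K = K"
    using uminus_K by (force intro: image_eqI[of _ _ "- x" for x])
  then have "uminus ` interior K = interior K"
    using interior_negations[of K] by simp
  then show ?thesis
    using assms uminus_K unfolding frontier_K by (metis imageI minus_minus)
qed

lemma radial_frontier_point:
  assumes "x \<in> K" "x \<noteq> 0"
  obtains r where "1 \<le> r" "r *\<^sub>R x \<in> frontier K"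
proof -
  obtain d where d: "0 < d" "0 + d *\<^sub>R x \<in> frontier K"
    using ray_to_frontier[OF compact_imp_bounded[OF compact_K] zero_interior \<open>x \<noteq> 0\<close>] by metis
  have "1 \<le> d"
    using scale_interior[OF \<open>x \<in> K\<close>, of d] d by (force simp: frontier_K not_le)
  with d that show thesis by simp
qed

end

text \<open>\<open>Q\<close> and \<open>P\<close> of the overview are \<open>pt a b\<close> and
  \<open>pt a (-b)\<close>, so the cap lies beyond the side with \<open>u\<close>-coordinate
  \<open>a\<close>. The other two corners follow by symmetry, and \<open>t\<close> is half the
  diagonal.\<close>

locale inscribed_rectangle = symmetric_body K + orthonormal_frame u v
  for K :: "(real^2) set" and u v :: "real^2" +
  fixes a b t :: real
  assumes a_pos: "0 < a" and b_pos: "0 < b" and t_pos: "0 < t" and t_sq: "t\<^sup>2 = a\<^sup>2 + b\<^sup>2"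
    and corner: "pt a b \<in> frontier K" and corner': "pt a (-b) \<in> frontier K"
begin

lemma corners: "pt a b \<in> frontier K" "pt (-a) b \<in> frontier K"
    "pt a (-b) \<in> frontier K" "pt (-a) (-b) \<in> frontier K"
  using corner corner' uminus_frontier[OF corner] uminus_frontier[OF corner'] by simp_all

lemma corners_K: "pt a b \<in> K" "pt (-a) b \<in> K" "pt a (-b) \<in> K" "pt (-a) (-b) \<in> K"
  using corners by (simp_all add: frontier_K)

text \<open>A point beyond the corner \<open>pt A B\<close> would, together with the two adjacent corners, push
  that corner into the interior.\<close>
lemma not_beyond_corner:
  assumes "pt A B \<in> frontier K" "pt A (-B) \<in> K" "z \<in> K" "A \<noteq> 0" "B \<noteq> 0"
  shows "z \<bullet> u / A \<le> 1 \<or> z \<bullet> v / B \<le> 1"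
proof (rule ccontr)
  assume *: "\<not> ?thesis"
  \<comment> \<open>\<open>x\<close> and \<open>y\<close> are the coordinates of \<open>z\<close> in
    the basis \<open>pt A B\<close>, \<open>pt A (-B)\<close>. The point \<open>s\<close> is chosen
    to cancel the second one, so that a convex combination of \<open>z\<close> and \<open>s\<close>
    is a multiple of the corner \<open>pt A B\<close>.\<close>
  define x y where "x = (z \<bullet> u / A + z \<bullet> v / B) / 2" and "y = (z \<bullet> u / A - z \<bullet> v / B) / 2"
  have z: "z \<bullet> u = (x + y) * A" "z \<bullet> v = (x - y) * B"
    using assms(4,5) by (simp_all add: x_def y_def field_simps)
  define s where "s = (if 0 \<le> y then - pt A (-B) else pt A (-B))"
  have s: "s \<in> K" using assms(2) uminus_K[OF assms(2)] by (simp add: s_def)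
  have ys: "\<bar>y\<bar> * (s \<bullet> u) = - y * A" "\<bar>y\<bar> * (s \<bullet> v) = y * B"
    by (simp_all add: s_def)
  have "(1 / (1 + \<bar>y\<bar>)) *\<^sub>R z + (\<bar>y\<bar> / (1 + \<bar>y\<bar>)) *\<^sub>R s \<in> K"
    using s assms(3) by (intro convexD[OF convex_K]) (auto simp: add_divide_distrib[symmetric])
  also have "(1 / (1 + \<bar>y\<bar>)) *\<^sub>R z + (\<bar>y\<bar> / (1 + \<bar>y\<bar>)) *\<^sub>R s = (x / (1 + \<bar>y\<bar>)) *\<^sub>R pt A B"
  proof -
    have 1: "z + \<bar>y\<bar> *\<^sub>R s = x *\<^sub>R pt A B"
      unfolding eq_iff using z ys by (simp add: inner_add_left algebra_simps)
    have "(1 / (1 + \<bar>y\<bar>)) *\<^sub>R z + (\<bar>y\<bar> / (1 + \<bar>y\<bar>)) *\<^sub>R s = (1 / (1 + \<bar>y\<bar>)) *\<^sub>R (z + \<bar>y\<bar> *\<^sub>R s)"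
      by (simp add: scaleR_add_right)
    then show ?thesis unfolding 1 by simp
  qed
  finally have "x / (1 + \<bar>y\<bar>) \<le> 1" using frontier_scale_le[OF assms(1)] by blast
  then have "x - \<bar>y\<bar> \<le> 1" by (simp add: pos_divide_le_eq)
  moreover have "1 < x + y" "1 < x - y"
    using * by (simp_all add: x_def y_def field_simps)
  ultimately show False by linarith
qed

text \<open>By \<open>not_beyond_corner\<close> at the four corners, \<open>K\<close> misses the
  open quadrant beyond each of them.\<close>

lemma cross_shaped:
  assumes "z \<in> K"
  shows "\<bar>z \<bullet> u\<bar> \<le> a \<or> \<bar>z \<bullet> v\<bar> \<le> b"
  using not_beyond_corner[OF corners(1) corners_K(3) assms]
    not_beyond_corner[OF corners(2) _ assms] not_beyond_corner[OF corners(3) _ assms]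
    not_beyond_corner[OF corners(4) _ assms] a_pos b_pos corners_K
  by (auto simp: field_simps abs_le_iff)

lemma rectangle_interior:
  assumes "\<bar>z \<bullet> u\<bar> < a" "\<bar>z \<bullet> v\<bar> < b"
  shows "z \<in> interior K"
proof (rule interiorI)
  let ?R = "{x. x \<bullet> u < a} \<inter> {x. -a < x \<bullet> u} \<inter> {x. x \<bullet> v < b} \<inter> {x. -b < x \<bullet> v}"
  show "open ?R" by (intro open_Int open_Collect_less continuous_intros)
  show "z \<in> ?R" using assms by auto
  show "?R \<subseteq> K"
    using rectangle_subset_convex[OF convex_K corners_K a_pos b_pos] by auto
qed

lemma frontier_top_ge:
  assumes "z \<in> frontier K" "\<bar>z \<bullet> u\<bar> < a" "0 < z \<bullet> v"
  shows "b \<le> z \<bullet> v"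
  using assms rectangle_interior[of z] by (force simp: frontier_K)

text \<open>If \<open>y\<close> were higher, \<open>z\<close> would lie strictly between
  \<open>y\<close> and the point of the horizontal axis below it. That point is interior, so
  \<open>z\<close> would be interior as well.\<close>

lemma frontier_top_max:
  assumes z: "z \<in> frontier K" "\<bar>z \<bullet> u\<bar> < a" "0 < z \<bullet> v" and y: "y \<in> K" "y \<bullet> u = z \<bullet> u"
  shows "y \<bullet> v \<le> z \<bullet> v"
proof (rule ccontr)
  assume less: "\<not> ?thesis"
  let ?c = "pt (z \<bullet> u) 0"
  define \<mu> where "\<mu> = z \<bullet> v / (y \<bullet> v)"
  have "0 < \<mu>" "\<mu> < 1" "\<mu> * (y \<bullet> v) = z \<bullet> v" using z(3) less by (auto simp: \<mu>_def)
  moreover have "z = (1 - \<mu>) *\<^sub>R ?c + \<mu> *\<^sub>R y"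
    unfolding eq_iff using y \<open>\<mu> * (y \<bullet> v) = z \<bullet> v\<close> by (simp add: inner_add_left algebra_simps)
  moreover have "?c \<noteq> y" using less z(3) by (metis not_le less_imp_le pt_v)
  ultimately have "z \<in> open_segment ?c y" by (auto simp: in_segment)
  moreover have "?c \<in> interior K" using z(2) b_pos by (intro rectangle_interior) auto
  ultimately show False
    using in_interior_closure_convex_segment[OF convex_K, of ?c y] y(1) z(1) closed_K
    by (auto simp: frontier_K)
qed

text \<open>The chord from \<open>y\<close> to \<open>y'\<close> stays in \<open>K\<close>, hence
  below the frontier point \<open>z\<close>. This is the concavity of the upper boundary, cleared of
  denominators; \<open>y\<close> and \<open>y'\<close> range over \<open>K\<close>, so that corners
  and the apex can be inserted.\<close>

lemma frontier_top_concave: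
  assumes z: "z \<in> frontier K" "\<bar>z \<bullet> u\<bar> < a" "0 < z \<bullet> v"
    and y: "y \<in> K" "y' \<in> K" "y \<bullet> u \<le> z \<bullet> u" "z \<bullet> u \<le> y' \<bullet> u" "y \<bullet> u < y' \<bullet> u"
  shows "(y \<bullet> v) * (y' \<bullet> u - z \<bullet> u) + (y' \<bullet> v) * (z \<bullet> u - y \<bullet> u) \<le> (z \<bullet> v) * (y' \<bullet> u - y \<bullet> u)"
proof -
  define \<mu> where "\<mu> = (z \<bullet> u - y \<bullet> u) / (y' \<bullet> u - y \<bullet> u)"
  have \<mu>: "0 \<le> \<mu>" "\<mu> \<le> 1" "\<mu> * (y' \<bullet> u - y \<bullet> u) = z \<bullet> u - y \<bullet> u"
    using y by (auto simp: \<mu>_def)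
  have "((1 - \<mu>) *\<^sub>R y + \<mu> *\<^sub>R y') \<bullet> v \<le> z \<bullet> v"
    using \<mu> y by (intro frontier_top_max[OF z] convexD[OF convex_K]) (auto simp: inner_add_left algebra_simps)
  then have "((1 - \<mu>) * (y \<bullet> v) + \<mu> * (y' \<bullet> v)) * (y' \<bullet> u - y \<bullet> u) \<le> (z \<bullet> v) * (y' \<bullet> u - y \<bullet> u)"
    using y by (intro mult_right_mono) (auto simp: inner_add_left)
  moreover have "((1 - \<mu>) * (y \<bullet> v) + \<mu> * (y' \<bullet> v)) * (y' \<bullet> u - y \<bullet> u)
      = (y \<bullet> v) * (y' \<bullet> u - z \<bullet> u) + (y' \<bullet> v) * (z \<bullet> u - y \<bullet> u)"
    using \<mu>(3) by algebra
  ultimately show ?thesis by simp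
qed

text \<open>The disc lies on one side of its tangent at the upper right
  (\<open>\<sigma> = 1\<close>) or upper left (\<open>\<sigma> = -1\<close>) corner. These tangents
  have slope \<open>a / b\<close> in absolute value, which is the source of the slope bound.\<close>

lemma inner_corner_le:
  assumes "norm z \<le> t" "\<sigma> = 1 \<or> \<sigma> = -1"
  shows "\<sigma> * a * (z \<bullet> u) + b * (z \<bullet> v) \<le> a\<^sup>2 + b\<^sup>2"
proof -
  have "(norm z)\<^sup>2 \<le> t\<^sup>2" using assms t_pos by (intro power_mono) auto
  then have "(z \<bullet> u)\<^sup>2 + (z \<bullet> v)\<^sup>2 \<le> a\<^sup>2 + b\<^sup>2" by (simp add: norm_sq t_sq)
  moreover have "0 \<le> (\<sigma> * a - z \<bullet> u)\<^sup>2 + (b - z \<bullet> v)\<^sup>2" by simp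
  moreover have "\<sigma>\<^sup>2 = 1" using assms(2) by auto
  ultimately show ?thesis by (auto simp: power2_diff power_mult_distrib algebra_simps)
qed

end

section \<open>The boundary inside the disc as the graph of a concave function\<close>

locale narrow_inscribed_rectangle = inscribed_rectangle +
  fixes X M :: real
  assumes narrow: "z \<in> frontier K \<Longrightarrow> norm z < t \<Longrightarrow> \<bar>z \<bullet> u\<bar> < a"
    and apex: "pt X M \<in> K" "norm (pt X M) \<le> t"
    and apex_max: "z \<in> K \<Longrightarrow> norm z \<le> t \<Longrightarrow> z \<bullet> v \<le> M"
begin

text \<open>By \<open>narrow\<close>, this set and its central reflection make up the whole frontier
  inside the open disc: a frontier point there has \<open>v\<close>-coordinate nonzero, being
  outside the open rectangle.\<close>

definition top_arc :: "(real^2) set" where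
  "top_arc = {z \<in> frontier K. norm z < t \<and> 0 < z \<bullet> v}"

lemma top_arcD:
  assumes "z \<in> top_arc"
  shows "z \<in> frontier K" "\<bar>z \<bullet> u\<bar> < a" "0 < z \<bullet> v" "z \<in> K" "norm z \<le> t" "b \<le> z \<bullet> v" "z \<bullet> v \<le> M"
  using assms narrow frontier_top_ge apex_max by (auto simp: top_arc_def frontier_K)

lemma norm_corner: "norm (pt a b) = t"
proof -
  have "(norm (pt a b))\<^sup>2 = t\<^sup>2" by (simp add: norm_sq t_sq)
  then show ?thesis using t_pos by (simp add: power2_eq_iff_nonneg)
qed

lemma b_le_M: "b \<le> M"
  using apex_max[OF corners_K(1)] norm_corner by simp

lemma top_arc_inj:
  assumes "z \<in> top_arc" "z' \<in> top_arc" "z \<bullet> u = z' \<bullet> u"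
  shows "z = z'"
  unfolding eq_iff using frontier_top_max assms top_arcD by (metis antisym)

text \<open>By concavity, a rising chord from \<open>z\<close> to \<open>z'\<close> is no steeper
  than the chord from the upper left corner to \<open>z\<close>, and the tangent bound
  \<open>inner_corner_le\<close> limits the slope of the latter to \<open>a / b\<close>. A falling
  chord is compared in the same way with the upper right corner.\<close>

lemma top_arc_slope:
  assumes "z \<in> top_arc" "z' \<in> top_arc" "z \<bullet> u < z' \<bullet> u"
  shows "b * \<bar>z' \<bullet> v - z \<bullet> v\<bar> \<le> a * (z' \<bullet> u - z \<bullet> u)"
proof -
  note z = top_arcD[OF assms(1)] and z' = top_arcD[OF assms(2)]
  let ?\<Delta> = "z' \<bullet> u - z \<bullet> u"
  have "b * (z' \<bullet> v - z \<bullet> v) \<le> a * ?\<Delta>"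
  proof -
    have "b * (z' \<bullet> u - z \<bullet> u) + (z' \<bullet> v) * (z \<bullet> u + a) \<le> (z \<bullet> v) * (z' \<bullet> u + a)"
      using frontier_top_concave[OF z(1-3) corners_K(2) z'(4)] z z' assms(3) by simp
    then have "(z' \<bullet> v - z \<bullet> v) * (z \<bullet> u + a) \<le> (z \<bullet> v - b) * ?\<Delta>"
      by (simp add: algebra_simps)
    then have "b * ((z' \<bullet> v - z \<bullet> v) * (z \<bullet> u + a)) \<le> b * ((z \<bullet> v - b) * ?\<Delta>)"
      using b_pos by (intro mult_left_mono) auto
    also have "\<dots> = (b * (z \<bullet> v - b)) * ?\<Delta>" by simp
    also have "\<dots> \<le> (a * (z \<bullet> u + a)) * ?\<Delta>"
      using inner_corner_le[OF z(5), of "-1"] assms(3)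
      by (intro mult_right_mono) (auto simp: algebra_simps power2_eq_square)
    finally have "(b * (z' \<bullet> v - z \<bullet> v)) * (z \<bullet> u + a) \<le> (a * ?\<Delta>) * (z \<bullet> u + a)"
      by (simp add: algebra_simps)
    then show ?thesis using z(2) by (subst (asm) mult_le_cancel_right) auto
  qed
  moreover have "b * (z \<bullet> v - z' \<bullet> v) \<le> a * ?\<Delta>"
  proof -
    have "(z \<bullet> v) * (a - z' \<bullet> u) + b * (z' \<bullet> u - z \<bullet> u) \<le> (z' \<bullet> v) * (a - z \<bullet> u)"
      using frontier_top_concave[OF z'(1-3) z(4) corners_K(1)] z z' assms(3) by simp
    then have "(z \<bullet> v - z' \<bullet> v) * (a - z' \<bullet> u) \<le> (z' \<bullet> v - b) * ?\<Delta>"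
      by (simp add: algebra_simps)
    then have "b * ((z \<bullet> v - z' \<bullet> v) * (a - z' \<bullet> u)) \<le> b * ((z' \<bullet> v - b) * ?\<Delta>)"
      using b_pos by (intro mult_left_mono) auto
    also have "\<dots> = (b * (z' \<bullet> v - b)) * ?\<Delta>" by simp
    also have "\<dots> \<le> (a * (a - z' \<bullet> u)) * ?\<Delta>"
      using inner_corner_le[OF z'(5), of 1] assms(3)
      by (intro mult_right_mono) (auto simp: algebra_simps power2_eq_square)
    finally have "(b * (z \<bullet> v - z' \<bullet> v)) * (a - z' \<bullet> u) \<le> (a * ?\<Delta>) * (a - z' \<bullet> u)"
      by (simp add: algebra_simps)
    then show ?thesis using z'(2) by (subst (asm) mult_le_cancel_right) auto
  qed
  ultimately show ?thesis by (auto simp: abs_if)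
qed

text \<open>The total variation, from the left end of the arc up to \<open>z\<close>, of the concave function
  whose graph is the arc.\<close>
definition height_variation :: "real^2 \<Rightarrow> real" where
  "height_variation z = (if z \<bullet> u \<le> X then z \<bullet> v else 2 * M - z \<bullet> v)"

text \<open>Concavity against the apex \<open>pt X M\<close> makes the heights increase to the left
  of \<open>X\<close> and decrease to the right of it. If \<open>X\<close> separates the two points,
  it suffices that both heights are at most \<open>M\<close>.\<close>

lemma height_variation_ge:
  assumes "z \<in> top_arc" "z' \<in> top_arc" "z \<bullet> u < z' \<bullet> u"
  shows "\<bar>z' \<bullet> v - z \<bullet> v\<bar> \<le> height_variation z' - height_variation z"
proof -
  note z = top_arcD[OF assms(1)] and z' = top_arcD[OF assms(2)]
  consider "z' \<bullet> u \<le> X" | "X < z \<bullet> u" | "z \<bullet> u \<le> X" "X < z' \<bullet> u" using assms(3) by linarith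
  then show ?thesis
  proof cases
    case 1
    have "(z \<bullet> v) * (X - z \<bullet> u) = (z \<bullet> v) * (X - z' \<bullet> u) + (z \<bullet> v) * (z' \<bullet> u - z \<bullet> u)"
      by (simp add: algebra_simps)
    also have "\<dots> \<le> (z \<bullet> v) * (X - z' \<bullet> u) + M * (z' \<bullet> u - z \<bullet> u)"
      using z assms(3) by (intro add_left_mono mult_right_mono) auto
    also have "\<dots> \<le> (z' \<bullet> v) * (X - z \<bullet> u)"
      using frontier_top_concave[OF z'(1-3) z(4) apex(1)] 1 assms(3) by simp
    finally have "z \<bullet> v \<le> z' \<bullet> v" using 1 assms(3) by (subst (asm) mult_le_cancel_right) auto
    then show ?thesis using 1 assms(3) by (simp add: height_variation_def)
  next
    case 2
    have "(z' \<bullet> v) * (z' \<bullet> u - X) = (z' \<bullet> v) * (z' \<bullet> u - z \<bullet> u) + (z' \<bullet> v) * (z \<bullet> u - X)"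
      by (simp add: algebra_simps)
    also have "\<dots> \<le> M * (z' \<bullet> u - z \<bullet> u) + (z' \<bullet> v) * (z \<bullet> u - X)"
      using z' assms(3) by (intro add_right_mono mult_right_mono) auto
    also have "\<dots> \<le> (z \<bullet> v) * (z' \<bullet> u - X)"
      using frontier_top_concave[OF z(1-3) apex(1) z'(4)] 2 assms(3) by simp
    finally have "z' \<bullet> v \<le> z \<bullet> v" using 2 assms(3) by (subst (asm) mult_le_cancel_right) auto
    then show ?thesis using 2 assms(3) by (simp add: height_variation_def)
  next
    case 3
    then show ?thesis using z z' by (simp add: height_variation_def abs_if)
  qed
qed

text \<open>Increments of this function dominate distances along the arc, hence lengths. The weight
  \<open>a / (2 * b)\<close> is half the slope bound of \<open>top_arc_slope\<close>.\<close>

definition arc_gauge :: "real^2 \<Rightarrow> real" where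
  "arc_gauge z = z \<bullet> u + a / (2 * b) * height_variation z"

text \<open>The \<open>u\<close>-coordinate varies by at most \<open>2 * a\<close> and the height
  variation by at most \<open>2 * (M - b)\<close>. The resulting range
  \<open>2 * a + (a / b) * (M - b)\<close> of the gauge equals \<open>a + a * M / b\<close>.\<close>

lemma arc_gauge_bounds:
  assumes "z \<in> top_arc"
  shows "- a / 2 \<le> arc_gauge z" "arc_gauge z \<le> a / 2 + a * M / b"
proof -
  note z = top_arcD[OF assms]
  have "b \<le> height_variation z" "height_variation z \<le> 2 * M - b"
    using z b_le_M by (auto simp: height_variation_def)
  define k where "k = a / (2 * b)"
  have k: "0 < k" "k * b = a / 2" "k * (2 * M - b) = a * M / b - a / 2"
    using a_pos b_pos by (simp_all add: k_def field_simps)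
  have "k * b \<le> k * height_variation z" "k * height_variation z \<le> k * (2 * M - b)"
    using mult_left_mono[OF \<open>b \<le> height_variation z\<close>, of k]
      mult_left_mono[OF \<open>height_variation z \<le> 2 * M - b\<close>, of k] k(1) by simp_all
  then show "- a / 2 \<le> arc_gauge z" "arc_gauge z \<le> a / 2 + a * M / b"
    unfolding arc_gauge_def k_def[symmetric] using z(2) k by linarith+
qed

text \<open>For \<open>b q \<le> a p\<close> one has \<open>p\<^sup>2 + q\<^sup>2 \<le> (p + a q / (2 b))\<^sup>2\<close>.\<close>
lemma dist_le_arc_gauge:
  assumes "z \<in> top_arc" "z' \<in> top_arc" "z \<bullet> u < z' \<bullet> u"
  shows "dist z z' \<le> arc_gauge z' - arc_gauge z"
proof -
  define p where "p = z' \<bullet> u - z \<bullet> u"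
  define q where "q = \<bar>z' \<bullet> v - z \<bullet> v\<bar>"
  define k where "k = a / (2 * b)"
  have pq: "0 < p" "0 \<le> q" "0 < k" using assms(3) a_pos b_pos by (auto simp: p_def q_def k_def)
  have "q \<le> 2 * k * p"
    using top_arc_slope[OF assms] b_pos by (simp add: p_def q_def k_def field_simps)
  then have "q * q \<le> (2 * k * p) * q" using pq by (intro mult_right_mono) auto
  have "(dist z z')\<^sup>2 = p\<^sup>2 + q\<^sup>2"
    unfolding dist_norm norm_sq p_def q_def by (simp add: inner_diff_left power2_eq_square algebra_simps)
  also have "\<dots> \<le> (p + k * q)\<^sup>2"
  proof -
    have "p\<^sup>2 + q\<^sup>2 + (k * q) * (k * q) \<le> p\<^sup>2 + (2 * k * p) * q + (k * q) * (k * q)"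
      using \<open>q * q \<le> (2 * k * p) * q\<close> by (simp only: power2_eq_square add_le_cancel_left add_le_cancel_right)
    also have "\<dots> = (p + k * q)\<^sup>2" by (simp only: power2_eq_square algebra_simps mult_2)
    finally show ?thesis using zero_le_square[of "k * q"] by linarith
  qed
  finally have "dist z z' \<le> p + k * q"
    by (rule power2_le_imp_le) (use pq in simp)
  also have "\<dots> \<le> p + k * (height_variation z' - height_variation z)"
    using height_variation_ge[OF assms] pq by (intro add_left_mono mult_left_mono) (auto simp: q_def)
  finally show ?thesis by (simp add: arc_gauge_def p_def k_def algebra_simps)
qed

end

section \<open>Length of the boundary inside the disc\<close>

lemma countable_components_open:
  fixes U :: "'a::euclidean_space set"
  assumes "open U"
  shows "countable (components U)"
  using assms pairwise_disjoint_components[of U]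
  by (intro countable_disjoint_open_subsets) (auto simp: open_components disjnt_def pairwise_def)

lemma components_real:
  fixes U :: "real set"
  assumes "open U" "C \<in> components U"
  shows "open C" "is_interval C" "C \<subseteq> U" "C \<noteq> {}" "C \<in> sets borel"
  using assms by (auto simp: open_components in_components_connected is_interval_connected_1 in_components_subset
      in_components_nonempty)

lemma emeasure_components:
  fixes U :: "real set"
  assumes "open U"
  shows "emeasure lborel U = (\<integral>\<^sup>+C. emeasure lborel C \<partial>count_space (components U))"
proof -
  have "emeasure lborel (\<Union>((\<lambda>C. C) ` components U)) = (\<integral>\<^sup>+C. emeasure lborel C \<partial>count_space (components U))"
    using assms components_real pairwise_disjoint_components[of U]
    by (intro emeasure_UN_countable countable_components_open) (auto simp: disjoint_family_on_def pairwise_def)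
  then show ?thesis by simp
qed

text \<open>The boxes enclosing the caps may overlap, hence subadditivity in place of additivity.
  The indicator functions are compared pointwise and the two integrals interchanged.\<close>

lemma emeasure_UN_countable_le:
  assumes [measurable]: "\<And>i. i \<in> I \<Longrightarrow> X i \<in> sets M" and I: "countable I"
  shows "emeasure M (\<Union>(X ` I)) \<le> (\<integral>\<^sup>+i. emeasure M (X i) \<partial>count_space I)"
proof -
  have "emeasure M (\<Union>(X ` I)) = (\<integral>\<^sup>+x. indicator (\<Union>(X ` I)) x \<partial>M)"
    using I by (intro nn_integral_indicator[symmetric] sets.countable_UN') auto
  also have "\<dots> \<le> (\<integral>\<^sup>+x. (\<integral>\<^sup>+i. indicator (X i) x \<partial>count_space I) \<partial>M)"
  proof (intro nn_integral_mono)
    fix x show "indicator (\<Union>(X ` I)) x \<le> (\<integral>\<^sup>+i. indicator (X i) x \<partial>count_space I)"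
    proof (cases "x \<in> \<Union>(X ` I)")
      case True
      then obtain i where "i \<in> I" "x \<in> X i" by auto
      then show ?thesis
        using nn_integral_ge_point[of i I "\<lambda>i. indicator (X i) x"] by (simp split: split_indicator)
    qed simp
  qed
  also have "\<dots> = (\<integral>\<^sup>+i. (\<integral>\<^sup>+x. indicator (X i) x \<partial>M) \<partial>count_space I)"
    using I by (subst nn_integral_count_space_nn_integral) auto
  also have "\<dots> = (\<integral>\<^sup>+i. emeasure M (X i) \<partial>count_space I)"
    by (intro nn_integral_cong) simp
  finally show ?thesis .
qed

text \<open>The increments of \<open>f\<close> telescope along an inscribed polygon.
  \<open>step\<close> also makes \<open>f\<close> monotone, so that the values at the first and last
  vertex may be replaced by those at \<open>p\<close> and \<open>q\<close>.\<close>

lemma curve_length_le: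
  assumes "p \<le> q"
    and step: "\<And>s s'. p \<le> s \<Longrightarrow> s \<le> s' \<Longrightarrow> s' \<le> q \<Longrightarrow> dist (\<gamma> s) (\<gamma> s') \<le> f s' - f s"
  shows "curve_length \<gamma> p q \<le> ennreal (f q - f p)"
  unfolding curve_length_def
proof (rule SUP_least)
  fix ts :: "real list" assume "ts \<in> {ts. sorted ts \<and> set ts \<subseteq> {p..q}}"
  then have ts: "sorted ts" "set ts \<subseteq> {p..q}" by auto
  show "(\<Sum>i<length ts - 1. ennreal (dist (\<gamma> (ts ! i)) (\<gamma> (ts ! Suc i)))) \<le> ennreal (f q - f p)"
  proof (cases "ts = []")
    case False
    let ?n = "length ts - 1"
    have in_pq: "ts ! i \<in> {p..q}" if "i \<le> ?n" for i
      using that False ts(2) nth_mem[of i ts] by (cases ts) auto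
    have d: "dist (\<gamma> (ts ! i)) (\<gamma> (ts ! Suc i)) \<le> f (ts ! Suc i) - f (ts ! i)" if "i < ?n" for i
      using that in_pq[of i] in_pq[of "Suc i"] sorted_nth_mono[OF ts(1), of i "Suc i"] by (intro step) auto
    have mono: "f s \<le> f s'" if "p \<le> s" "s \<le> s'" "s' \<le> q" for s s'
      using step[OF that] zero_le_dist[of "\<gamma> s" "\<gamma> s'"] by linarith
    have "(\<Sum>i<?n. ennreal (dist (\<gamma> (ts ! i)) (\<gamma> (ts ! Suc i))))
        = ennreal (\<Sum>i<?n. dist (\<gamma> (ts ! i)) (\<gamma> (ts ! Suc i)))"
      by (intro sum_ennreal) auto
    also have "\<dots> \<le> ennreal (\<Sum>i<?n. f (ts ! Suc i) - f (ts ! i))"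
      using d by (intro ennreal_leI sum_mono) auto
    also have "(\<Sum>i<?n. f (ts ! Suc i) - f (ts ! i)) = f (ts ! ?n) - f (ts ! 0)"
      using sum_lessThan_telescope[of "\<lambda>i. f (ts ! i)"] .
    also have "ennreal \<dots> \<le> ennreal (f q - f p)"
      using mono[of p "ts ! 0"] mono[of "ts ! ?n" q] in_pq[of 0] in_pq[of ?n] assms(1)
      by (intro ennreal_leI) auto
    finally show ?thesis .
  qed simp
qed

lemma emeasure_interval_le_diameter:
  fixes C :: "real set"
  assumes "C \<noteq> {}" and diam: "\<And>p q. p \<in> C \<Longrightarrow> q \<in> C \<Longrightarrow> p \<le> q \<Longrightarrow> q - p \<le> D"
  shows "emeasure lborel C \<le> ennreal D"
proof -
  obtain c where "c \<in> C" using assms(1) by auto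
  have D: "x - y \<le> D" if "x \<in> C" "y \<in> C" for x y
    using diam[OF that(2,1)] diam[OF \<open>c \<in> C\<close> \<open>c \<in> C\<close>] by linarith
  have below: "bdd_below C" using D[OF \<open>c \<in> C\<close>] by (intro bdd_belowI[of _ "c - D"]) (simp add: algebra_simps)
  have "x - D \<le> Inf C" if "x \<in> C" for x
    using assms(1) D[OF that] by (intro cInf_greatest) (auto simp: algebra_simps)
  then have "C \<subseteq> {Inf C..Inf C + D}"
    using below by (force intro: cInf_lower)
  then have "emeasure lborel C \<le> emeasure lborel {Inf C..Inf C + D}" by (intro emeasure_mono) auto
  also have "\<dots> = ennreal D" using D[OF \<open>c \<in> C\<close> \<open>c \<in> C\<close>] by simp
  finally show ?thesis .
qed

lemma disjoint_intervals_less: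
  fixes I J :: "real set"
  assumes "is_interval I" "is_interval J" "I \<inter> J = {}" "x \<in> I" "y \<in> J" "x < y" "x' \<in> I" "y' \<in> J"
  shows "x' < y'"
proof (rule ccontr)
  assume "\<not> x' < y'"
  then consider "y' \<le> x" | "x \<le> y'" "y' \<le> x'" by linarith
  then show False
  proof cases
    case 1
    then have "x \<in> J" using assms(2,5,6,8) unfolding is_interval_1 by (meson less_imp_le)
    then show False using assms(3,4) by auto
  next
    case 2
    then have "y' \<in> I" using assms(1,4,7) unfolding is_interval_1 by meson
    then show False using assms(3,8) by auto
  qed
qed

text \<open>On each component of \<open>U\<close> the injective function \<open>h\<close> is monotone, so the length of the
  component is at most the increment of \<open>g\<close>; the ranges of \<open>g\<close> on different components do not
  overlap because those of \<open>h\<close> do not.\<close>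
lemma emeasure_arc_le:
  fixes \<gamma> :: "real \<Rightarrow> 'a::metric_space" and g h :: "real \<Rightarrow> real"
  assumes "open U" and h: "continuous_on U h" "inj_on h U"
    and len: "\<And>p q. p \<le> q \<Longrightarrow> {p..q} \<subseteq> U \<Longrightarrow> curve_length \<gamma> p q = ennreal (q - p)"
    and step: "\<And>s s'. s \<in> U \<Longrightarrow> s' \<in> U \<Longrightarrow> h s < h s' \<Longrightarrow> dist (\<gamma> s) (\<gamma> s') \<le> g s' - g s"
    and bounds: "\<And>s. s \<in> U \<Longrightarrow> A \<le> g s" "\<And>s. s \<in> U \<Longrightarrow> g s \<le> B"
  shows "emeasure lborel U \<le> ennreal (B - A)"
proof -
  \<comment> \<open>The open interval spanned by the values of \<open>g\<close> on a component:
    open, because the spans of two components may share an endpoint.\<close>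
  define \<Psi> where "\<Psi> C = {Inf (g ` C)<..<Sup (g ` C)}" for C
  have bdd: "bdd_below (g ` C)" "bdd_above (g ` C)" if "C \<subseteq> U" for C
    by (rule bdd_belowI2[where m = A], use that bounds in blast)
      (rule bdd_aboveI2[where M = B], use that bounds in blast)
  have diam: "q - p \<le> Sup (g ` C) - Inf (g ` C)" if C: "C \<in> components U" "p \<in> C" "q \<in> C" "p \<le> q" for C p q
  proof -
    note C' = components_real[OF \<open>open U\<close> C(1)]
    have pq: "{p..q} \<subseteq> C" by (auto intro: mem_is_interval_1_I[OF C'(2) C(2,3)])
    have "strict_mono_on C h \<or> strict_antimono_on C h"
      using injective_eq_monotone_map[OF C'(2)] h C'(3) continuous_on_subset inj_on_subset by blast
    then have "q - p \<le> g q - g p \<or> q - p \<le> g p - g q"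
    proof
      assume mono: "strict_mono_on C h"
      have "curve_length \<gamma> p q \<le> ennreal (g q - g p)"
      proof (rule curve_length_le[OF C(4)])
        fix s s' assume "p \<le> s" "s \<le> s'" "s' \<le> q"
        then show "dist (\<gamma> s) (\<gamma> s') \<le> g s' - g s"
          using pq C'(3) step[of s s'] mono by (cases "s = s'") (auto simp: strict_mono_on_def subset_iff)
      qed
      then show ?thesis using len[OF C(4)] pq C'(3) by (auto simp: ennreal_le_iff2)
    next
      assume mono: "strict_antimono_on C h"
      \<comment> \<open>If \<open>h\<close> decreases, the arc is traversed backwards, and
        \<open>- g\<close> takes the place of \<open>g\<close>.\<close>
      have "curve_length \<gamma> p q \<le> ennreal (- g q - - g p)"
      proof (rule curve_length_le[OF C(4)])
        fix s s' assume "p \<le> s" "s \<le> s'" "s' \<le> q"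
        then show "dist (\<gamma> s) (\<gamma> s') \<le> - g s' - - g s"
          using pq C'(3) step[of s' s] mono
          by (cases "s = s'") (auto simp: monotone_on_def subset_iff dist_commute)
      qed
      then show ?thesis using len[OF C(4)] pq C'(3) by (auto simp: ennreal_le_iff2)
    qed
    moreover have "g q - g p \<le> Sup (g ` C) - Inf (g ` C)" "g p - g q \<le> Sup (g ` C) - Inf (g ` C)"
      using bdd[OF C'(3)] C by (auto intro!: diff_mono cSup_upper cInf_lower)
    ultimately show ?thesis by linarith
  qed
  have le: "emeasure lborel C \<le> emeasure lborel (\<Psi> C)" if "C \<in> components U" for C
  proof -
    have ne: "C \<noteq> {}" using components_real[OF \<open>open U\<close> that] by simp
    then obtain c where "c \<in> C" by auto
    have "emeasure lborel C \<le> ennreal (Sup (g ` C) - Inf (g ` C))"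
      using ne diam[OF that] by (rule emeasure_interval_le_diameter)
    also have "\<dots> = emeasure lborel (\<Psi> C)"
      using diam[OF that \<open>c \<in> C\<close> \<open>c \<in> C\<close>] by (simp add: \<Psi>_def)
    finally show ?thesis .
  qed
  have less: "\<Psi> C \<inter> \<Psi> D = {}" if CD: "C \<in> components U" "D \<in> components U" "C \<inter> D = {}"
    and xy: "x \<in> C" "y \<in> D" "h x < h y" for C D x y
  proof -
    note C = components_real[OF \<open>open U\<close> CD(1)] and D = components_real[OF \<open>open U\<close> CD(2)]
    have int: "is_interval (h ` C)" "is_interval (h ` D)"
      using C D continuous_on_subset[OF h(1)]
      by (auto simp: is_interval_connected_1 intro!: connected_continuous_image)
    have "h ` C \<inter> h ` D = {}" using h(2) CD(3) C(3) D(3) unfolding inj_on_def by blast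
    then have "h x' < h y'" if "x' \<in> C" "y' \<in> D" for x' y'
      using disjoint_intervals_less[OF int, of "h x" "h y"] xy that by auto
    then have "dist (\<gamma> x') (\<gamma> y') \<le> g y' - g x'" if "x' \<in> C" "y' \<in> D" for x' y'
      using that C(3) D(3) by (blast intro: step)
    then have "g x' \<le> g y'" if "x' \<in> C" "y' \<in> D" for x' y'
      using that zero_le_dist[of "\<gamma> x'" "\<gamma> y'"] by (meson diff_ge_0_iff_ge order_trans)
    then have "Sup (g ` C) \<le> Inf (g ` D)"
      using C(4) D(4) by (intro cSup_least cInf_greatest) auto
    then show ?thesis by (auto simp: \<Psi>_def)
  qed
  have disj: "disjoint_family_on \<Psi> (components U)"
    unfolding disjoint_family_on_def
  proof (intro ballI impI)
    fix C D assume CD: "C \<in> components U" "D \<in> components U" "C \<noteq> D"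
    then have "C \<inter> D = {}" using pairwise_disjoint_components[of U] by (auto simp: pairwise_def)
    moreover obtain x y where xy: "x \<in> C" "y \<in> D"
      using CD components_real(4)[OF \<open>open U\<close>] by blast
    moreover have "h x \<noteq> h y"
      using xy \<open>C \<inter> D = {}\<close> CD in_components_subset h(2) by (metis disjoint_iff inj_onD subsetD)
    ultimately show "\<Psi> C \<inter> \<Psi> D = {}"
      using less[OF CD(1,2), of x y] less[OF CD(2,1), of y x] by (auto simp: neq_iff Int_commute)
  qed
  show ?thesis
  proof (cases "U = {}")
    case False
    then have "A \<le> B" using bounds by force
    have "emeasure lborel U = (\<integral>\<^sup>+C. emeasure lborel C \<partial>count_space (components U))"
      by (rule emeasure_components[OF \<open>open U\<close>])
    also have "\<dots> \<le> (\<integral>\<^sup>+C. emeasure lborel (\<Psi> C) \<partial>count_space (components U))"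
      using le by (intro nn_integral_mono) simp
    also have "\<dots> = emeasure lborel (\<Union>(\<Psi> ` components U))"
      by (rule emeasure_UN_countable[symmetric], simp add: \<Psi>_def, rule countable_components_open, fact, fact)
    also have "\<dots> \<le> emeasure lborel {A..B}"
    proof (intro emeasure_mono subsetI)
      fix x assume "x \<in> \<Union>(\<Psi> ` components U)"
      then obtain C where C: "C \<in> components U" "Inf (g ` C) < x" "x < Sup (g ` C)" by (auto simp: \<Psi>_def)
      have "C \<noteq> {}" "C \<subseteq> U" using components_real[OF \<open>open U\<close> C(1)] by auto
      then have "A \<le> Inf (g ` C)" "Sup (g ` C) \<le> B"
        using bounds by (auto intro!: cInf_greatest cSup_least)
      with C show "x \<in> {A..B}" by auto
    qed simp
    also have "\<dots> = ennreal (B - A)" using \<open>A \<le> B\<close> by simp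
    finally show ?thesis .
  qed simp
qed

lemma curve_length_uminus:
  fixes \<gamma> :: "real \<Rightarrow> 'a::real_normed_vector"
  shows "curve_length (\<lambda>s. - \<gamma> s) p q = curve_length \<gamma> p q"
  by (simp add: curve_length_def dist_minus)

section \<open>Inner length of a parametrized boundary\<close>

context narrow_inscribed_rectangle
begin

text \<open>An instance of \<open>emeasure_arc_le\<close>, with \<open>h\<close> the
  \<open>u\<close>-coordinate along the curve, injective because the arc is a graph, and
  \<open>g\<close> the gauge. On the open interval of parameters the set is open and the curve
  injective.\<close>

lemma emeasure_top_arc:
  assumes \<gamma>: "continuous_on {0..L} \<gamma>" "inj_on \<gamma> {0..<L}" "\<gamma> ` {0..L} \<subseteq> frontier K"
    and len: "\<And>p q. 0 \<le> p \<Longrightarrow> p \<le> q \<Longrightarrow> q \<le> L \<Longrightarrow> curve_length \<gamma> p q = ennreal (q - p)"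
  shows "emeasure lborel {s \<in> {0<..<L}. norm (\<gamma> s) < t \<and> 0 < \<gamma> s \<bullet> v} \<le> ennreal (a + a * M / b)"
proof -
  let ?U = "{s \<in> {0<..<L}. norm (\<gamma> s) < t \<and> 0 < \<gamma> s \<bullet> v}"
  have cont: "continuous_on {0<..<L} \<gamma>" using \<gamma>(1) by (rule continuous_on_subset) auto
  have U: "\<gamma> s \<in> top_arc" "0 < s" "s < L" if "s \<in> ?U" for s
    using that \<gamma>(3) by (auto simp: top_arc_def)
  have "emeasure lborel ?U \<le> ennreal ((a / 2 + a * M / b) - (- a / 2))"
  proof (rule emeasure_arc_le)
    have "open ({z :: real^2. norm z < t} \<inter> {z. 0 < z \<bullet> v})"
      by (intro open_Int open_Collect_less continuous_intros)
    then have "open ({0<..<L} \<inter> \<gamma> -` ({z. norm z < t} \<inter> {z. 0 < z \<bullet> v}))"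
      by (intro continuous_open_preimage cont) auto
    moreover have "{0<..<L} \<inter> \<gamma> -` ({z. norm z < t} \<inter> {z. 0 < z \<bullet> v}) = ?U" by auto
    ultimately show "open ?U" by simp
    show "continuous_on ?U (\<lambda>s. \<gamma> s \<bullet> u)"
      by (intro continuous_intros continuous_on_subset[OF cont]) auto
    show "inj_on (\<lambda>s. \<gamma> s \<bullet> u) ?U"
    proof (rule inj_onI)
      fix s s' assume s: "s \<in> ?U" "s' \<in> ?U" "\<gamma> s \<bullet> u = \<gamma> s' \<bullet> u"
      then have "\<gamma> s = \<gamma> s'" using U top_arc_inj by blast
      then show "s = s'" using \<gamma>(2) s unfolding inj_on_def by auto
    qed
    fix p q :: real assume pq: "p \<le> q" "{p..q} \<subseteq> ?U"
    then have "p \<in> ?U" "q \<in> ?U" by (auto simp del: mem_Collect_eq)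
    then have "0 < p" "q < L" by auto
    then show "curve_length \<gamma> p q = ennreal (q - p)" using pq(1) by (intro len) auto
  next
    fix s s' assume "s \<in> ?U" "s' \<in> ?U" "\<gamma> s \<bullet> u < \<gamma> s' \<bullet> u"
    then show "dist (\<gamma> s) (\<gamma> s') \<le> arc_gauge (\<gamma> s') - arc_gauge (\<gamma> s)"
      using U dist_le_arc_gauge by blast
  next
    fix s assume "s \<in> ?U"
    then show "- a / 2 \<le> arc_gauge (\<gamma> s)" "arc_gauge (\<gamma> s) \<le> a / 2 + a * M / b"
      using U arc_gauge_bounds by blast+
  qed
  then show ?thesis by (simp add: algebra_simps)
qed

text \<open>The lower half of the inner boundary is the upper half for the reflected curve
  \<open>- \<gamma>\<close>, so \<open>emeasure_top_arc\<close> applies twice. No frontier point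
  inside the disc has \<open>v\<close>-coordinate 0, and the parameters 0 and \<open>L\<close> form
  a null set.\<close>

lemma inner_length_le_apex:
  assumes \<gamma>: "continuous_on {0..L} \<gamma>" "inj_on \<gamma> {0..<L}" "\<gamma> ` {0..L} \<subseteq> frontier K"
    and len: "\<And>p q. 0 \<le> p \<Longrightarrow> p \<le> q \<Longrightarrow> q \<le> L \<Longrightarrow> curve_length \<gamma> p q = ennreal (q - p)"
  shows "emeasure lborel {s \<in> {0..L}. norm (\<gamma> s) < t} \<le> ennreal (2 * (a + a * M / b))"
proof -
  define T where "T \<beta> = {s \<in> {0<..<L}. norm (\<beta> s) < t \<and> 0 < \<beta> s \<bullet> v}" for \<beta> :: "real \<Rightarrow> real^2"
  have borel: "T \<beta> \<in> sets borel" if "continuous_on {0..L} \<beta>" for \<beta>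
  proof -
    have "open ({z :: real^2. norm z < t} \<inter> {z. 0 < z \<bullet> v})"
      by (intro open_Int open_Collect_less continuous_intros)
    then have "open ({0<..<L} \<inter> \<beta> -` ({z. norm z < t} \<inter> {z. 0 < z \<bullet> v}))"
      using that by (intro continuous_open_preimage) (auto intro: continuous_on_subset)
    moreover have "{0<..<L} \<inter> \<beta> -` ({z. norm z < t} \<inter> {z. 0 < z \<bullet> v}) = T \<beta>" by (auto simp: T_def)
    ultimately show ?thesis by simp
  qed
  have bT: "T \<gamma> \<in> sets borel" "T (\<lambda>s. - \<gamma> s) \<in> sets borel"
    by (intro borel \<gamma>(1) continuous_on_minus)+
  have T1: "emeasure lborel (T \<gamma>) \<le> ennreal (a + a * M / b)"
    unfolding T_def using assms by (rule emeasure_top_arc)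
  have T2: "emeasure lborel (T (\<lambda>s. - \<gamma> s)) \<le> ennreal (a + a * M / b)"
    unfolding T_def using assms uminus_frontier
    by (intro emeasure_top_arc continuous_intros) (auto simp: curve_length_uminus inj_on_def)
  have nz: "\<gamma> s \<bullet> v \<noteq> 0" if "s \<in> {0..L}" "norm (\<gamma> s) < t" for s
  proof -
    have "\<gamma> s \<in> frontier K" using that \<gamma>(3) by blast
    then show ?thesis
      using that narrow[of "\<gamma> s"] rectangle_interior[of "\<gamma> s"] b_pos by (auto simp: frontier_K)
  qed
  have "{s \<in> {0..L}. norm (\<gamma> s) < t} \<subseteq> T \<gamma> \<union> T (\<lambda>s. - \<gamma> s) \<union> {0, L}"
    using nz by (force simp: T_def)
  then have "emeasure lborel {s \<in> {0..L}. norm (\<gamma> s) < t} \<le> emeasure lborel (T \<gamma> \<union> T (\<lambda>s. - \<gamma> s) \<union> {0, L})"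
    using bT by (intro emeasure_mono) (simp_all add: sets.Un sets.insert_in_sets)
  also have "\<dots> \<le> emeasure lborel (T \<gamma> \<union> T (\<lambda>s. - \<gamma> s)) + emeasure lborel {0, L}"
    using bT by (intro emeasure_subadditive) auto
  also have "\<dots> \<le> emeasure lborel (T \<gamma>) + emeasure lborel (T (\<lambda>s. - \<gamma> s)) + emeasure lborel {0, L}"
    using bT by (intro add_right_mono emeasure_subadditive) auto
  also have "emeasure lborel {0, L} = 0" by (intro emeasure_lborel_countable) auto
  also have "emeasure lborel (T \<gamma>) + emeasure lborel (T (\<lambda>s. - \<gamma> s)) + 0 \<le> ennreal (a + a * M / b) + ennreal (a + a * M / b)"
    using T1 T2 by (simp add: add_mono)
  also have "\<dots> = ennreal (2 * (a + a * M / b))"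
    using a_pos b_pos b_le_M by (subst ennreal_plus[symmetric]) auto
  finally show ?thesis .
qed

end

context inscribed_rectangle
begin

text \<open>With \<open>pt X M\<close> a highest point of \<open>K\<close> in the closed disc,
  \<open>b\<close> times the length bound \<open>2 * (a + a * M / b)\<close> is exactly the area of
  the inscribed hexagon.\<close>

lemma inner_length_le_area:
  assumes narrow: "\<And>z. z \<in> frontier K \<Longrightarrow> norm z < t \<Longrightarrow> \<bar>z \<bullet> u\<bar> < a"
    and \<gamma>: "continuous_on {0..L} \<gamma>" "inj_on \<gamma> {0..<L}" "\<gamma> ` {0..L} \<subseteq> frontier K"
    and len: "\<And>p q. 0 \<le> p \<Longrightarrow> p \<le> q \<Longrightarrow> q \<le> L \<Longrightarrow> curve_length \<gamma> p q = ennreal (q - p)"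
  shows "b * measure lborel {s \<in> {0..L}. norm (\<gamma> s) < t} \<le> measure lborel (K \<inter> cball 0 t)"
proof -
  let ?S = "K \<inter> cball 0 t"
  have norm_pt: "norm (pt x y) = t" if "x\<^sup>2 = a\<^sup>2" "y\<^sup>2 = b\<^sup>2" for x y
  proof -
    have "(norm (pt x y))\<^sup>2 = t\<^sup>2" using that by (simp add: norm_sq t_sq)
    then show ?thesis using t_pos by (simp add: power2_eq_iff_nonneg)
  qed
  have S: "compact ?S" "convex ?S"
    using compact_K convex_K by (auto intro: compact_Int convex_Int)
  have S_corners: "pt a b \<in> ?S" "pt (-a) b \<in> ?S" "pt a (-b) \<in> ?S" "pt (-a) (-b) \<in> ?S"
    using corners_K by (simp_all add: norm_pt)
  have "continuous_on ?S (\<lambda>z. z \<bullet> v)" by (intro continuous_intros)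
  then obtain Z where Z: "Z \<in> ?S" "\<And>z. z \<in> ?S \<Longrightarrow> z \<bullet> v \<le> Z \<bullet> v"
    using continuous_attains_sup[OF S(1)] S_corners(1) by (metis empty_iff)
  define X M where "X = Z \<bullet> u" and "M = Z \<bullet> v"
  have Z_pt: "pt X M = Z" using expand[of Z] by (simp add: X_def M_def)
  have apex: "pt X M \<in> K" "norm (pt X M) \<le> t" using Z(1) by (simp_all add: Z_pt)
  have top: "z \<bullet> v \<le> M" if "z \<in> K" "norm z \<le> t" for z using that Z(2)[of z] by (simp add: M_def)
  interpret narrow_inscribed_rectangle K u v a b t X M
    by unfold_locales (use apex top narrow in blast)+
  have "pt X M \<in> ?S" "pt (-X) (-M) \<in> ?S"
    using apex uminus_K[OF apex(1)] norm_minus_cancel[of "pt X M"] by simp_all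
  then have area: "4 * a * b + 2 * a * (M - b) \<le> measure lborel ?S"
    using a_pos b_pos b_le_M S S_corners by (intro hexagon_area)
  have "measure lborel {s \<in> {0..L}. norm (\<gamma> s) < t} \<le> 2 * (a + a * M / b)"
    using inner_length_le_apex[OF \<gamma> len] a_pos b_pos b_le_M by (simp add: measure_def enn2real_leI)
  then have "b * measure lborel {s \<in> {0..L}. norm (\<gamma> s) < t} \<le> b * (2 * (a + a * M / b))"
    using b_pos by (intro mult_left_mono) auto
  also have "\<dots> = 4 * a * b + 2 * a * (M - b)" using b_pos by (simp add: field_simps)
  finally show ?thesis using area by simp
qed

end

section \<open>Boundary arcs outside the disc\<close>

text \<open>The intermediate value theorem for \<open>x\<close> and \<open>y\<close> in either
  order. That the zero lies between them lets callers keep it inside a given arc.\<close>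

lemma zero_between:
  fixes f :: "real \<Rightarrow> real"
  assumes "continuous_on {p..q} f" "x \<in> {p..q}" "y \<in> {p..q}" "f x \<le> 0" "0 \<le> f y"
  obtains z where "min x y \<le> z" "z \<le> max x y" "f z = 0"
proof (cases "x \<le> y")
  case True
  have "continuous_on {x..y} f" using assms(1) by (rule continuous_on_subset) (use assms in auto)
  then show thesis using IVT'[of f x 0 y] assms True that by auto
next
  case False
  have "continuous_on {y..x} f" using assms(1) by (rule continuous_on_subset) (use assms in auto)
  then show thesis using IVT2'[of f x 0 y] assms False that by auto
qed

text \<open>The endpoints are the infimum and supremum of \<open>C\<close>. Were one of them in
  \<open>U\<close>, a larger connected subset of \<open>U\<close> would contradict the maximality of
  the component.\<close>

lemma component_real_endpoints:
  fixes U :: "real set"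
  assumes "open U" "bounded U" "C \<in> components U"
  obtains s s' where "s < s'" "C = {s<..<s'}" "s \<notin> U" "s' \<notin> U"
proof -
  note C = components_real[OF assms(1,3)]
  have "bounded C" using C(3) assms(2) bounded_subset by blast
  then have bdd: "bdd_below C" "bdd_above C"
    by (auto simp: bounded_imp_bdd_below bounded_imp_bdd_above)
  define s s' where "s = Inf C" and "s' = Sup C"
  obtain q where "\<forall>x\<in>C. - q < x" "\<forall>x\<in>C. x < q"
    using bounded_subset_box_symmetric[OF \<open>bounded C\<close>] by (metis subsetD box_real(1) greaterThanLessThan_iff)
  then have notin: "s \<notin> C" "s' \<notin> C"
    unfolding s_def s'_def using Inf_notin_open[OF C(1)] Sup_notin_open[OF C(1)] by blast+
  have sub: "C \<subseteq> {s<..<s'}"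
  proof
    fix x assume "x \<in> C"
    then have "s \<le> x" "x \<le> s'" using bdd by (auto simp: s_def s'_def intro: cInf_lower cSup_upper)
    then show "x \<in> {s<..<s'}" using \<open>x \<in> C\<close> notin by (auto simp: less_le)
  qed
  obtain m where "m \<in> C" using C(4) by auto
  have left: "x \<in> C" if x: "s < x" "x \<le> m" for x
  proof -
    obtain y where "y \<in> C" "y < x" using x(1) cInf_less_iff[OF C(4) bdd(1)] unfolding s_def by blast
    then show ?thesis using mem_is_interval_1_I[OF C(2) \<open>y \<in> C\<close> \<open>m \<in> C\<close>] x \<open>y < x\<close> by auto
  qed
  have right: "x \<in> C" if x: "x < s'" "m \<le> x" for x
  proof -
    obtain y where "y \<in> C" "x < y" using x(1) less_cSup_iff[OF C(4) bdd(2)] unfolding s'_def by blast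
    then show ?thesis using mem_is_interval_1_I[OF C(2) \<open>m \<in> C\<close> \<open>y \<in> C\<close>] x \<open>x < y\<close> by auto
  qed
  have eq: "C = {s<..<s'}" using sub left right by (meson greaterThanLessThan_iff linear subsetI subset_antisym)
  have m: "s < m" "m < s'" using \<open>m \<in> C\<close> sub by auto
  have "s \<notin> U"
  proof
    assume "s \<in> U"
    have "x \<in> U" if "x \<in> {s..m}" for x
      using that left[of x] C(3) \<open>s \<in> U\<close> by (cases "x = s") auto
    then have "{s..m} \<subseteq> U" by blast
    then have "{s..m} \<subseteq> C"
      using \<open>m \<in> C\<close> m by (intro components_maximal[OF assms(3)]) auto
    moreover have "s \<in> {s..m}" using m by simp
    ultimately show False using notin by blast
  qed
  moreover have "s' \<notin> U"
  proof
    assume "s' \<in> U"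
    have "x \<in> U" if "x \<in> {m..s'}" for x
      using that right[of x] C(3) \<open>s' \<in> U\<close> by (cases "x = s'") auto
    then have "{m..s'} \<subseteq> U" by blast
    then have "{m..s'} \<subseteq> C"
      using \<open>m \<in> C\<close> m by (intro components_maximal[OF assms(3)]) auto
    moreover have "s' \<in> {m..s'}" using m by simp
    ultimately show False using notin by blast
  qed
  ultimately show thesis using that[of s s'] m eq by auto
qed

text \<open>For negative \<open>r\<close> the multiple is reflected first, so a frontier point is
  farthest from the centre on its whole line through the centre, not only on its ray.\<close>

lemma (in symmetric_body) frontier_multiple:
  assumes z: "z \<in> frontier K" and rz: "r *\<^sub>R z \<in> K"
  shows "norm (r *\<^sub>R z) \<le> norm z"
proof -
  have "\<bar>r\<bar> *\<^sub>R z \<in> K" using rz uminus_K[OF rz] by (auto simp: abs_if)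
  then show ?thesis using frontier_scale_le[OF z] by (simp add: mult_left_le_one_le)
qed

section \<open>A single outer arc and its cap\<close>

locale outer_arc = inscribed_rectangle +
  fixes \<beta> :: "real \<Rightarrow> real^2" and s\<^sub>1 s\<^sub>2 :: real
  assumes s12: "s\<^sub>1 < s\<^sub>2" and cont: "continuous_on {s\<^sub>1..s\<^sub>2} \<beta>"
    and in_K: "s \<in> {s\<^sub>1..s\<^sub>2} \<Longrightarrow> \<beta> s \<in> K"
    and starts: "\<beta> s\<^sub>1 = pt a b" and ends: "\<beta> s\<^sub>2 = pt a (-b)"
    and outside: "s \<in> {s\<^sub>1<..<s\<^sub>2} \<Longrightarrow> t < norm (\<beta> s)"
begin

text \<open>The rectangle lies in the disc, so a point outside the disc must be in one of the arms
  of the cross of \<open>cross_shaped\<close> that stick out of the rectangle.\<close>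

lemma outside_cases:
  assumes "s \<in> {s\<^sub>1<..<s\<^sub>2}"
  shows "a < \<bar>\<beta> s \<bullet> u\<bar> \<and> \<bar>\<beta> s \<bullet> v\<bar> \<le> b \<or> \<bar>\<beta> s \<bullet> u\<bar> \<le> a \<and> b < \<bar>\<beta> s \<bullet> v\<bar>"
proof -
  have "\<not> (\<bar>\<beta> s \<bullet> u\<bar> \<le> a \<and> \<bar>\<beta> s \<bullet> v\<bar> \<le> b)"
  proof
    assume "\<bar>\<beta> s \<bullet> u\<bar> \<le> a \<and> \<bar>\<beta> s \<bullet> v\<bar> \<le> b"
    then have "\<bar>\<beta> s \<bullet> u\<bar>\<^sup>2 + \<bar>\<beta> s \<bullet> v\<bar>\<^sup>2 \<le> a\<^sup>2 + b\<^sup>2"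
      by (intro add_mono power_mono) auto
    then have "(norm (\<beta> s))\<^sup>2 \<le> t\<^sup>2" by (simp add: norm_sq t_sq)
    then have "norm (\<beta> s) \<le> t" by (rule power2_le_imp_le) (use t_pos in simp)
    then show False using outside[OF assms] by simp
  qed
  then show ?thesis using cross_shaped[of "\<beta> s"] in_K[of s] assms by auto
qed

text \<open>A connectedness argument. The function \<open>k\<close> is positive on the horizontal
  arms of the cross and negative on the vertical ones, so it has no zero on the open arc. It is
  positive where the arc meets the horizontal axis, so the arc stays in the horizontal arms. It
  cannot pass from the right arm to the left one without the \<open>u\<close>-coordinate
  vanishing.\<close>

lemma beyond_right_side:
  assumes s: "s \<in> {s\<^sub>1<..<s\<^sub>2}"
  shows "a < \<beta> s \<bullet> u"
proof -
  have cont_u: "continuous_on {s\<^sub>1..s\<^sub>2} (\<lambda>s. \<beta> s \<bullet> u)" and cont_v: "continuous_on {s\<^sub>1..s\<^sub>2} (\<lambda>s. \<beta> s \<bullet> v)"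
    by (intro continuous_intros cont)+
  define k where "k s = \<bar>\<beta> s \<bullet> u\<bar> / a - \<bar>\<beta> s \<bullet> v\<bar> / b" for s
  have cont_k: "continuous_on {s\<^sub>1..s\<^sub>2} k"
    unfolding k_def using a_pos b_pos by (intro continuous_intros cont_u cont_v) auto
  have k_pos: "a < \<bar>\<beta> s \<bullet> u\<bar> \<Longrightarrow> 0 < k s" and k_neg: "b < \<bar>\<beta> s \<bullet> v\<bar> \<Longrightarrow> k s < 0"
    if "s \<in> {s\<^sub>1<..<s\<^sub>2}" for s
  proof -
    assume "a < \<bar>\<beta> s \<bullet> u\<bar>"
    then have "1 < \<bar>\<beta> s \<bullet> u\<bar> / a" "\<bar>\<beta> s \<bullet> v\<bar> / b \<le> 1"
      using outside_cases[OF that] a_pos b_pos by auto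
    then show "0 < k s" by (simp add: k_def)
  next
    assume "b < \<bar>\<beta> s \<bullet> v\<bar>"
    then have "\<bar>\<beta> s \<bullet> u\<bar> / a \<le> 1" "1 < \<bar>\<beta> s \<bullet> v\<bar> / b"
      using outside_cases[OF that] a_pos b_pos by auto
    then show "k s < 0" by (simp add: k_def)
  qed
  obtain m where m: "s\<^sub>1 \<le> m" "m \<le> s\<^sub>2" "\<beta> m \<bullet> v = 0"
    by (rule zero_between[OF cont_v, of s\<^sub>2 s\<^sub>1]) (use s12 starts ends b_pos in auto)
  then have "m \<in> {s\<^sub>1<..<s\<^sub>2}" using starts ends b_pos by (cases "m = s\<^sub>1 \<or> m = s\<^sub>2") auto
  then have "0 < k m" using outside_cases[of m] k_pos m b_pos by force
  have abs: "a < \<bar>\<beta> r \<bullet> u\<bar>" if r: "r \<in> {s\<^sub>1<..<s\<^sub>2}" for r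
  proof (rule ccontr)
    assume "\<not> ?thesis"
    then have "k r < 0" using outside_cases[OF r] k_neg[OF r] by auto
    then obtain z where z: "min r m \<le> z" "z \<le> max r m" "k z = 0"
      by - (rule zero_between[OF cont_k, of r m], use r m \<open>0 < k m\<close> in auto)
    then have "z \<in> {s\<^sub>1<..<s\<^sub>2}" using r \<open>m \<in> {s\<^sub>1<..<s\<^sub>2}\<close> by (auto simp: min_def max_def split: if_splits)
    then show False using z(3) outside_cases[of z] k_pos[of z] k_neg[of z] by auto
  qed
  show ?thesis
  proof (rule ccontr)
    assume "\<not> ?thesis"
    then have "\<beta> s \<bullet> u < 0" using abs[OF s] a_pos by auto
    then obtain z where z: "min s s\<^sub>1 \<le> z" "z \<le> max s s\<^sub>1" "\<beta> z \<bullet> u = 0"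
      by - (rule zero_between[OF cont_u, of s s\<^sub>1], use s starts a_pos in auto)
    then have "z \<noteq> s\<^sub>1" using starts a_pos by auto
    then have "z \<in> {s\<^sub>1<..<s\<^sub>2}" using z s by auto
    then show False using abs[of z] z(3) a_pos by auto
  qed
qed

text \<open>Were the \<open>u\<close>-coordinate of \<open>z\<close> at least \<open>a\<close>, the
  line through 0 and \<open>z\<close> would separate the endpoints of the arc, and the arc would
  cross it outside the disc. This contradicts \<open>frontier_multiple\<close>, as \<open>z\<close>
  is inside the disc.\<close>

lemma right_side_covered:
  assumes z: "z \<in> frontier K" "norm z < t"
  shows "z \<bullet> u < a"
proof (rule ccontr)
  assume "\<not> ?thesis"
  then have za: "a \<le> z \<bullet> u" by simp
  have "(norm z)\<^sup>2 < t\<^sup>2" using z(2) by (intro power_strict_mono) auto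
  moreover have "a\<^sup>2 \<le> (z \<bullet> u)\<^sup>2" using za a_pos by (intro power_mono) auto
  ultimately have "\<bar>z \<bullet> v\<bar>\<^sup>2 < b\<^sup>2" by (simp add: norm_sq t_sq)
  then have zv: "\<bar>z \<bullet> v\<bar> < b" by (rule power2_less_imp_less) (use b_pos in simp)
  have "a * b \<le> (z \<bullet> u) * b" using za b_pos by (intro mult_right_mono) auto
  moreover have "a * \<bar>z \<bullet> v\<bar> < a * b" using zv a_pos by simp
  ultimately have "a * \<bar>z \<bullet> v\<bar> < (z \<bullet> u) * b" by linarith
  then have zab: "\<bar>z \<bullet> v * a\<bar> < z \<bullet> u * b" using a_pos by (simp add: abs_mult mult.commute)
  \<comment> \<open>\<open>f s\<close> is the cross product of \<open>z\<close> and
    \<open>\<beta> s\<close>; a zero means that \<open>\<beta> s\<close> is a multiple of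
    \<open>z\<close>.\<close>
  define f where "f s = (z \<bullet> u) * (\<beta> s \<bullet> v) - (z \<bullet> v) * (\<beta> s \<bullet> u)" for s
  have "continuous_on {s\<^sub>1..s\<^sub>2} f" unfolding f_def by (intro continuous_intros cont)
  moreover have f12: "0 < f s\<^sub>1" "f s\<^sub>2 < 0"
    using zab by (auto simp: f_def starts ends)
  ultimately obtain s where s: "s\<^sub>1 \<le> s" "s \<le> s\<^sub>2" "f s = 0"
    by - (rule zero_between[of s\<^sub>1 s\<^sub>2 f s\<^sub>2 s\<^sub>1], use s12 in auto)
  then have "s \<in> {s\<^sub>1<..<s\<^sub>2}" using f12 by (cases "s = s\<^sub>1 \<or> s = s\<^sub>2") auto
  define r where "r = (\<beta> s \<bullet> u) / (z \<bullet> u)"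
  have "\<beta> s = r *\<^sub>R z"
    unfolding eq_iff using s(3) za a_pos by (simp add: r_def f_def field_simps)
  then have "norm (\<beta> s) \<le> norm z"
    using frontier_multiple[OF z(1), of r] in_K[of s] s by simp
  then show False using outside[OF \<open>s \<in> {s\<^sub>1<..<s\<^sub>2}\<close>] z(2) by simp
qed

lemma narrow:
  assumes "z \<in> frontier K" "norm z < t"
  shows "\<bar>z \<bullet> u\<bar> < a"
  using right_side_covered[OF assms] right_side_covered[of "- z"] assms uminus_frontier by auto

text \<open>The cap is swept out by the segments from 0 to the arc. \<open>H\<close> is the largest
  \<open>u\<close>-coordinate on the arc; reaching it from one endpoint and returning to the other
  takes parameter length at least \<open>2 * (H - a)\<close>. Points
  \<open>r *\<^sub>R \<beta> s\<close> stay in the strip of half-width \<open>b\<close>, and being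
  outside the disc forces their \<open>u\<close>-coordinate above \<open>a\<close>.\<close>

lemma cap_in_box:
  assumes lip: "\<And>s s'. s\<^sub>1 \<le> s \<Longrightarrow> s \<le> s' \<Longrightarrow> s' \<le> s\<^sub>2 \<Longrightarrow> dist (\<beta> s) (\<beta> s') \<le> s' - s"
  obtains H where "a \<le> H" "2 * (H - a) \<le> s\<^sub>2 - s\<^sub>1"
    "\<And>s r. s \<in> {s\<^sub>1<..<s\<^sub>2} \<Longrightarrow> 0 \<le> r \<Longrightarrow> r \<le> 1 \<Longrightarrow> t < norm (r *\<^sub>R \<beta> s) \<Longrightarrow>
      r *\<^sub>R \<beta> s \<in> {x. a \<le> x \<bullet> u \<and> x \<bullet> u \<le> H \<and> - b \<le> x \<bullet> v \<and> x \<bullet> v \<le> b}"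
proof -
  have "continuous_on {s\<^sub>1..s\<^sub>2} (\<lambda>s. \<beta> s \<bullet> u)" by (intro continuous_intros cont)
  then obtain m where m: "m \<in> {s\<^sub>1..s\<^sub>2}" "\<And>s. s \<in> {s\<^sub>1..s\<^sub>2} \<Longrightarrow> \<beta> s \<bullet> u \<le> \<beta> m \<bullet> u"
    using continuous_attains_sup[of "{s\<^sub>1..s\<^sub>2}" "\<lambda>s. \<beta> s \<bullet> u"] s12 by auto
  define H where "H = \<beta> m \<bullet> u"
  have "a \<le> H" using m(2)[of s\<^sub>1] s12 starts by (simp add: H_def)
  have le_dist: "x \<bullet> u - y \<bullet> u \<le> dist x y" for x y
    using norm_cauchy_schwarz[of "x - y" u] norm_u by (simp add: inner_diff_left dist_norm)
  have "H - a \<le> m - s\<^sub>1" "H - a \<le> s\<^sub>2 - m"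
    using le_dist[of "\<beta> m" "\<beta> s\<^sub>1"] le_dist[of "\<beta> m" "\<beta> s\<^sub>2"] lip[of s\<^sub>1 m] lip[of m s\<^sub>2] m(1) starts ends
    by (auto simp: H_def dist_commute)
  then have "2 * (H - a) \<le> s\<^sub>2 - s\<^sub>1" by simp
  moreover have "r *\<^sub>R \<beta> s \<in> {x. a \<le> x \<bullet> u \<and> x \<bullet> u \<le> H \<and> - b \<le> x \<bullet> v \<and> x \<bullet> v \<le> b}"
    if s: "s \<in> {s\<^sub>1<..<s\<^sub>2}" and r: "0 \<le> r" "r \<le> 1" "t < norm (r *\<^sub>R \<beta> s)" for s r
  proof -
    have "a < \<beta> s \<bullet> u" using s by (rule beyond_right_side)
    then have bv: "\<bar>\<beta> s \<bullet> v\<bar> \<le> b" using outside_cases[OF s] by auto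
    have "r * \<bar>\<beta> s \<bullet> v\<bar> \<le> 1 * \<bar>\<beta> s \<bullet> v\<bar>" using r by (intro mult_right_mono) auto
    then have v: "\<bar>r * (\<beta> s \<bullet> v)\<bar> \<le> b" using bv r by (simp add: abs_mult)
    have "r * (\<beta> s \<bullet> u) \<le> 1 * (\<beta> s \<bullet> u)" using r \<open>a < \<beta> s \<bullet> u\<close> a_pos by (intro mult_right_mono) auto
    then have u: "r * (\<beta> s \<bullet> u) \<le> H" using m(2)[of s] s by (simp add: H_def)
    have "t\<^sup>2 < (norm (r *\<^sub>R \<beta> s))\<^sup>2" using r(3) t_pos by (intro power_strict_mono) auto
    moreover have "\<bar>r * (\<beta> s \<bullet> v)\<bar>\<^sup>2 \<le> b\<^sup>2" using v by (intro power_mono) auto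
    ultimately have "a\<^sup>2 < (r * (\<beta> s \<bullet> u))\<^sup>2" unfolding norm_sq t_sq by simp
    then have "a < r * (\<beta> s \<bullet> u)"
      by (rule power2_less_imp_less) (use r(1) \<open>a < \<beta> s \<bullet> u\<close> a_pos in simp)
    then show ?thesis using u v by auto
  qed
  ultimately show thesis using that[of H] \<open>a \<le> H\<close> by blast
qed

end

text \<open>For points of equal norm, \<open>P + Q\<close> and \<open>Q - P\<close> are orthogonal;
  normalising them gives the frame. The two inequalities between the points make \<open>b\<close>
  and \<open>a\<close> positive.\<close>

lemma frame_of_equidistant_points:
  fixes P Q :: "real^2"
  assumes "norm P = t" "norm Q = t" "P \<noteq> Q" "P \<noteq> - Q"
  obtains u v a b where "orthonormal_frame u v" "0 < a" "0 < b" "t\<^sup>2 = a\<^sup>2 + b\<^sup>2"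
    "Q = orthonormal_frame.pt u v a b" "P = orthonormal_frame.pt u v a (-b)"
proof -
  define a b where "a = norm (P + Q) / 2" and "b = norm (Q - P) / 2"
  define u v where "u = (1 / (2 * a)) *\<^sub>R (P + Q)" and "v = (1 / (2 * b)) *\<^sub>R (Q - P)"
  have pos: "0 < a" "0 < b"
    using assms(3,4) by (auto simp: a_def b_def add_eq_0_iff)
  have "(P + Q) \<bullet> (Q - P) = Q \<bullet> Q - P \<bullet> P"
    by (simp add: inner_diff_right inner_add_left inner_commute[of P Q])
  also have "\<dots> = 0"
    using power2_norm_eq_inner[of P] power2_norm_eq_inner[of Q] assms(1,2) by simp
  finally have "(P + Q) \<bullet> (Q - P) = 0" .
  then have frame: "orthonormal_frame u v"
    using pos by unfold_locales (simp_all add: u_def v_def, simp_all add: a_def b_def)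
  interpret orthonormal_frame u v by fact
  have "a *\<^sub>R u = (1/2) *\<^sub>R (P + Q)" "b *\<^sub>R v = (1/2) *\<^sub>R (Q - P)"
    using pos by (simp_all add: u_def v_def)
  then have Q: "Q = pt a b" and P: "P = pt a (-b)"
    unfolding pt_def by (simp_all add: scaleR_add_right[symmetric] scaleR_diff_right[symmetric] flip: scaleR_2)
  have "t\<^sup>2 = (norm (pt a b))\<^sup>2" using Q assms(2) by simp
  then have "t\<^sup>2 = a\<^sup>2 + b\<^sup>2" by (simp add: norm_sq)
  then show thesis using that[OF frame pos] P Q by blast
qed

lemma parallel_real2:
  fixes x z :: "real^2"
  assumes "z \<noteq> 0" "z$1 * x$2 = z$2 * x$1"
  obtains r where "x = r *\<^sub>R z"
proof (cases "z$1 = 0")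
  case True
  with assms have "z$2 \<noteq> 0" by (auto simp: vec_eq_iff forall_2)
  then show thesis using that[of "x$2 / z$2"] True assms by (auto simp: vec_eq_iff forall_2)
next
  case False
  then show thesis using that[of "x$1 / z$1"] assms by (auto simp: vec_eq_iff forall_2 field_simps)
qed

lemma (in orthonormal_frame) compact_rectangle:
  "compact {x. p \<le> x \<bullet> u \<and> x \<bullet> u \<le> q \<and> r \<le> x \<bullet> v \<and> x \<bullet> v \<le> s}" (is "compact ?S")
proof -
  have eq: "?S = {x. p \<le> x \<bullet> u} \<inter> {x. x \<bullet> u \<le> q} \<inter> {x. r \<le> x \<bullet> v} \<inter> {x. x \<bullet> v \<le> s}" by auto
  have "closed ?S" unfolding eq by (intro closed_Int closed_Collect_le continuous_intros)
  moreover have "norm x \<le> \<bar>p\<bar> + \<bar>q\<bar> + (\<bar>r\<bar> + \<bar>s\<bar>)" if "x \<in> ?S" for x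
  proof -
    have "norm x \<le> \<bar>x \<bullet> u\<bar> + \<bar>x \<bullet> v\<bar>"
      using norm_triangle_ineq[of "(x \<bullet> u) *\<^sub>R u" "(x \<bullet> v) *\<^sub>R v"] expand[of x] norm_u norm_v
      by (simp add: pt_def)
    moreover have "\<bar>x \<bullet> u\<bar> \<le> \<bar>p\<bar> + \<bar>q\<bar>" "\<bar>x \<bullet> v\<bar> \<le> \<bar>r\<bar> + \<bar>s\<bar>" using that by auto
    ultimately show ?thesis by linarith
  qed
  then have "bounded ?S" unfolding bounded_iff by blast
  ultimately show ?thesis by (simp add: compact_eq_bounded_closed)
qed

text \<open>Two parametrizations of the frontier occur: \<open>\<gamma>\<close> measures the inner
  length, while \<open>\<beta>\<close> starts inside the disc and runs through the outer arcs. The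
  set \<open>B\<close> is the box of \<open>cap_in_box\<close> for the arc over
  \<open>C\<close>.\<close>

lemma outer_component_box:
  fixes K :: "(real^2) set" and \<beta> \<gamma> :: "real \<Rightarrow> real^2"
  assumes K: "symmetric_body K"
    and lip: "\<And>s s'. 0 \<le> s \<Longrightarrow> s \<le> s' \<Longrightarrow> s' \<le> L \<Longrightarrow> dist (\<beta> s) (\<beta> s') \<le> s' - s"
    and cont: "continuous_on {0..L} \<beta>"
    and closed: "\<beta> L = \<beta> 0" and inj: "inj_on \<beta> {0..<L}" and sub: "\<beta> ` {0..L} \<subseteq> frontier K"
    and base: "norm (\<beta> 0) < t"
    and \<gamma>: "continuous_on {0..L'} \<gamma>" "inj_on \<gamma> {0..<L'}" "\<gamma> ` {0..L'} \<subseteq> frontier K"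
    and len: "\<And>p q. 0 \<le> p \<Longrightarrow> p \<le> q \<Longrightarrow> q \<le> L' \<Longrightarrow> curve_length \<gamma> p q = ennreal (q - p)"
    and C: "C \<in> components {s \<in> {0<..<L}. t < norm (\<beta> s)}"
  obtains B where "compact B"
    "\<And>s r. s \<in> C \<Longrightarrow> 0 \<le> r \<Longrightarrow> r \<le> 1 \<Longrightarrow> t < norm (r *\<^sub>R \<beta> s) \<Longrightarrow> r *\<^sub>R \<beta> s \<in> B"
    "measure lborel {s \<in> {0..L'}. norm (\<gamma> s) < t} * measure lborel B
      \<le> measure lborel (K \<inter> cball 0 t) * measure lborel C"
proof -
  interpret symmetric_body K by fact
  let ?U = "{s \<in> {0<..<L}. t < norm (\<beta> s)}"
  have "0 < t" using base norm_ge_zero[of "\<beta> 0"] by linarith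
  have "open ({z :: real^2. t < norm z})" by (intro open_Collect_less continuous_intros)
  then have "open ({0<..<L} \<inter> \<beta> -` {z. t < norm z})"
    using cont by (intro continuous_open_preimage) (auto intro: continuous_on_subset)
  moreover have "{0<..<L} \<inter> \<beta> -` {z. t < norm z} = ?U" by auto
  ultimately have "open ?U" by simp
  have "bounded ?U" by (rule bounded_subset[of "{0..L}"]) auto
  obtain s1 s2 where s12: "s1 < s2" and C_eq: "C = {s1<..<s2}" and notin: "s1 \<notin> ?U" "s2 \<notin> ?U"
    by (rule component_real_endpoints[OF \<open>open ?U\<close> \<open>bounded ?U\<close> C])
  have CU: "{s1<..<s2} \<subseteq> ?U" using in_components_subset[OF C] C_eq by simp
  then have "{s1<..<s2} \<subseteq> {0..L}" by auto
  then have "closure {s1<..<s2} \<subseteq> {0..L}" by (rule closure_minimal) simp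
  then have s12_L: "{s1..s2} \<subseteq> {0..L}" using s12 by simp
  then have "0 \<le> s1" "s2 \<le> L" using s12 by auto
  have cont12: "continuous_on {s1..s2} \<beta>" using cont s12_L by (rule continuous_on_subset)
  \<comment> \<open>The bound passes to the endpoints of the component by continuity. As these are
    outside \<open>?U\<close> but strictly between 0 and \<open>L\<close>, their images turn out to
    lie exactly on the circle.\<close>
  have ge: "t \<le> norm (\<beta> s)" if "s \<in> {s1..s2}" for s
  proof (rule continuous_ge_on_closure[of "{s1<..<s2}" "\<lambda>s. norm (\<beta> s)"])
    show "continuous_on (closure {s1<..<s2}) (\<lambda>s. norm (\<beta> s))"
      using s12 cont12 by (auto intro: continuous_on_norm)
    show "s \<in> closure {s1<..<s2}" using s12 that by simp
  qed (use CU in auto)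
  have "s1 \<noteq> 0" "s2 \<noteq> L" using ge[of s1] ge[of s2] s12 base closed by auto
  then have strict: "0 < s1" "s2 < L" using \<open>0 \<le> s1\<close> \<open>s2 \<le> L\<close> by auto
  have nP: "norm (\<beta> s2) = t" and nQ: "norm (\<beta> s1) = t"
    using notin ge[of s1] ge[of s2] s12 strict by auto
  have in_K: "\<beta> s \<in> frontier K" if "s \<in> {s1..s2}" for s
    using sub s12_L that by auto
  have PQ: "\<beta> s2 \<noteq> \<beta> s1" using inj s12 strict unfolding inj_on_def by force
  \<comment> \<open>If the endpoints were antipodal, the arc would meet the line through 0 and
    \<open>\<beta> 0\<close> at norm at least \<open>t\<close>. By \<open>frontier_multiple\<close>
    points of \<open>K\<close> on that line have norm at most that of \<open>\<beta> 0\<close>,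
    which is less than \<open>t\<close>.\<close>
  have "\<beta> s2 \<noteq> - \<beta> s1"
  proof
    assume opp: "\<beta> s2 = - \<beta> s1"
    define z where "z = \<beta> 0"
    have "0 \<le> L" using s12 strict by simp
    then have zf: "z \<in> frontier K" using sub by (auto simp: z_def)
    then have "z \<noteq> 0" using zero_interior by (auto simp: frontier_K)
    define f where "f s = z$1 * \<beta> s $ 2 - z$2 * \<beta> s $ 1" for s
    have cont_f: "continuous_on {s1..s2} f" unfolding f_def by (intro continuous_intros cont12)
    have "f s2 = - f s1" by (simp add: f_def opp)
    obtain s where s: "s \<in> {s1..s2}" "f s = 0"
    proof (cases "f s1 \<le> 0")
      case True
      then show thesis
        by - (rule zero_between[OF cont_f, of s1 s2], use s12 \<open>f s2 = - f s1\<close> that in auto)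
    next
      case False
      then show thesis
        by - (rule zero_between[OF cont_f, of s2 s1], use s12 \<open>f s2 = - f s1\<close> that in auto)
    qed
    obtain r where "\<beta> s = r *\<^sub>R z"
      using parallel_real2[OF \<open>z \<noteq> 0\<close>, of "\<beta> s"] s(2) by (auto simp: f_def)
    then have "norm (\<beta> s) \<le> norm z"
      using frontier_multiple[OF zf, of r] in_K[OF s(1)] by (simp add: frontier_K)
    then show False using ge[OF s(1)] base by (simp add: z_def)
  qed
  then obtain u v a b where frame: "orthonormal_frame u v" and pos: "0 < a" "0 < b" "t\<^sup>2 = a\<^sup>2 + b\<^sup>2"
    and Q: "\<beta> s1 = orthonormal_frame.pt u v a b" and P: "\<beta> s2 = orthonormal_frame.pt u v a (-b)"
    using frame_of_equidistant_points[OF nP nQ PQ] by metis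
  interpret orthonormal_frame u v by fact
  interpret outer_arc K u v a b t \<beta> s1 s2
  proof unfold_locales
    show "pt a b \<in> frontier K" "pt a (-b) \<in> frontier K"
      using in_K[of s1] in_K[of s2] s12 P Q by auto
    show "\<beta> s \<in> K" if "s \<in> {s1..s2}" for s using in_K[OF that] by (simp add: frontier_K)
    show "t < norm (\<beta> s)" if "s \<in> {s1<..<s2}" for s using CU that by auto
  qed fact+
  obtain H where H: "a \<le> H" "2 * (H - a) \<le> s2 - s1"
    "\<And>s r. s \<in> {s1<..<s2} \<Longrightarrow> 0 \<le> r \<Longrightarrow> r \<le> 1 \<Longrightarrow> t < norm (r *\<^sub>R \<beta> s) \<Longrightarrow>
      r *\<^sub>R \<beta> s \<in> {x. a \<le> x \<bullet> u \<and> x \<bullet> u \<le> H \<and> - b \<le> x \<bullet> v \<and> x \<bullet> v \<le> b}"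
    by (rule cap_in_box) (use lip strict in auto)
  let ?B = "{x. a \<le> x \<bullet> u \<and> x \<bullet> u \<le> H \<and> - b \<le> x \<bullet> v \<and> x \<bullet> v \<le> b}"
  let ?a = "measure lborel {s \<in> {0..L'}. norm (\<gamma> s) < t}" and ?k = "measure lborel (K \<inter> cball 0 t)"
  have B: "compact ?B" by (rule compact_rectangle)
  then have "measure lborel ?B = measure lebesgue ?B"
    by (intro measure_completion[symmetric]) (simp add: borel_compact)
  also have "\<dots> = (H - a) * (b - - b)" using H(1) pos by (intro measure_rectangle) auto
  finally have mB: "measure lborel ?B = 2 * (H - a) * b" by simp
  \<comment> \<open>The half-height \<open>b\<close> of the box goes to the inner length, where
    \<open>inner_length_le_area\<close> absorbs it; the remaining factor is bounded by the length of
    the component.\<close>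
  have "?a * measure lborel ?B = (b * ?a) * (2 * (H - a))" by (simp add: mB)
  also have "\<dots> \<le> ?k * (2 * (H - a))"
    using H(1) inner_length_le_area[OF narrow \<gamma> len] by (intro mult_right_mono) auto
  also have "\<dots> \<le> ?k * (s2 - s1)" using H(2) by (intro mult_left_mono) auto
  also have "s2 - s1 = measure lborel C" using s12 by (simp add: C_eq)
  finally show thesis using that[of ?B] B H(3) C_eq by blast
qed

section \<open>Comparison of length and area\<close>

lemma dist_le_curve_length:
  assumes "p \<le> q"
  shows "ennreal (dist (\<gamma> p) (\<gamma> q)) \<le> curve_length \<gamma> p q"
  unfolding curve_length_def
  by (rule SUP_upper2[of "[p, q]"]) (use assms in auto)

lemma arc_length_parametrization_lipschitz:
  assumes "arc_length_parametrization \<gamma> L C" "0 \<le> s" "s \<le> s'" "s' \<le> L"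
  shows "dist (\<gamma> s) (\<gamma> s') \<le> s' - s"
proof -
  have "ennreal (dist (\<gamma> s) (\<gamma> s')) \<le> ennreal (s' - s)"
    using dist_le_curve_length[OF assms(3), of \<gamma>] assms by (simp add: arc_length_parametrization_def)
  then show ?thesis using assms(3) by (simp add: ennreal_le_iff)
qed

lemma borel_Collect_continuous_on:
  fixes f :: "real \<Rightarrow> 'a::topological_space"
  assumes f: "continuous_on {p..q} f" and T: "open {z. P z}"
  shows "{s \<in> {p..q}. P (f s)} \<in> sets borel"
proof -
  have "f -` {z. P z} \<inter> {p..q} \<in> sets (restrict_space borel {p..q})"
    using measurable_sets[OF borel_measurable_continuous_on_restrict[OF f] borel_open[OF T]]
    by (simp add: space_restrict_space)
  then have "f -` {z. P z} \<inter> {p..q} \<in> sets borel"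
    by (subst (asm) sets_restrict_space_iff) auto
  also have "f -` {z. P z} \<inter> {p..q} = {s \<in> {p..q}. P (f s)}" by auto
  finally show ?thesis .
qed

text \<open>Serves to move the starting point into the disc: an outer arc through the original
  starting point would be split by the parameter interval.\<close>

definition rotate_start :: "real \<Rightarrow> real \<Rightarrow> (real \<Rightarrow> 'a) \<Rightarrow> real \<Rightarrow> 'a" where
  "rotate_start s\<^sub>0 L \<gamma> s = \<gamma> (if s + s\<^sub>0 \<le> L then s + s\<^sub>0 else s + s\<^sub>0 - L)"

lemma rotate_start_closed_curve:
  assumes \<gamma>: "arc_length_parametrization \<gamma> L C" and s0: "0 \<le> s\<^sub>0" "s\<^sub>0 < L"
  defines "\<beta> \<equiv> rotate_start s\<^sub>0 L \<gamma>"
  shows "\<beta> 0 = \<gamma> s\<^sub>0" "\<beta> L = \<beta> 0" "inj_on \<beta> {0..<L}" "\<beta> ` {0..L} = C"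
    "\<And>s s'. 0 \<le> s \<Longrightarrow> s \<le> s' \<Longrightarrow> s' \<le> L \<Longrightarrow> dist (\<beta> s) (\<beta> s') \<le> s' - s"
proof -
  have L: "0 < L" "\<gamma> L = \<gamma> 0" "inj_on \<gamma> {0..<L}" "\<gamma> ` {0..L} = C"
    using \<gamma> by (auto simp: arc_length_parametrization_def)
  note lip = arc_length_parametrization_lipschitz[OF \<gamma>]
  have \<beta>: "\<beta> s = \<gamma> (if s + s\<^sub>0 \<le> L then s + s\<^sub>0 else s + s\<^sub>0 - L)" for s
    by (simp add: \<beta>_def rotate_start_def)
  \<comment> \<open>At \<open>s + s\<^sub>0 = L\<close> both branches agree because
    \<open>\<gamma> L = \<gamma> 0\<close>. The strict version keeps the parameters in
    \<open>{0..<L}\<close>, where \<open>\<gamma>\<close> is injective.\<close>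
  have \<beta>': "\<beta> s = \<gamma> (if s + s\<^sub>0 < L then s + s\<^sub>0 else s + s\<^sub>0 - L)" for s
    using L(2) by (cases "s + s\<^sub>0" L rule: linorder_cases) (auto simp: \<beta>)
  show "\<beta> 0 = \<gamma> s\<^sub>0" "\<beta> L = \<beta> 0" using s0 L(2) by (auto simp: \<beta>)
  show "inj_on \<beta> {0..<L}"
  proof (rule inj_onI)
    fix s s' assume s: "s \<in> {0..<L}" "s' \<in> {0..<L}" "\<beta> s = \<beta> s'"
    have "(if s + s\<^sub>0 < L then s + s\<^sub>0 else s + s\<^sub>0 - L) = (if s' + s\<^sub>0 < L then s' + s\<^sub>0 else s' + s\<^sub>0 - L)"
      using s(3) unfolding \<beta>' by (rule inj_onD[OF L(3)]) (use s s0 in auto)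
    then show "s = s'" using s s0 by (auto split: if_splits)
  qed
  show "\<beta> ` {0..L} = C"
  proof
    show "\<beta> ` {0..L} \<subseteq> C" using s0 by (auto simp: \<beta> L(4)[symmetric])
    show "C \<subseteq> \<beta> ` {0..L}"
    proof
      fix y assume "y \<in> C"
      then obtain r where r: "0 \<le> r" "r \<le> L" "y = \<gamma> r" using L(4) by auto
      show "y \<in> \<beta> ` {0..L}"
      proof (cases "s\<^sub>0 \<le> r")
        case True
        then show ?thesis using r s0 by (intro image_eqI[of _ _ "r - s\<^sub>0"]) (auto simp: \<beta>)
      next
        case False
        then show ?thesis using r s0 by (intro image_eqI[of _ _ "r + L - s\<^sub>0"]) (auto simp: \<beta>')
      qed
    qed
  qed
  fix s s' assume s: "0 \<le> s" "s \<le> s'" "s' \<le> L"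
  consider "s' + s\<^sub>0 \<le> L" | "L < s + s\<^sub>0" | "s + s\<^sub>0 \<le> L" "L < s' + s\<^sub>0" by linarith
  then show "dist (\<beta> s) (\<beta> s') \<le> s' - s"
  proof cases
    case 1
    then show ?thesis using lip[of "s + s\<^sub>0" "s' + s\<^sub>0"] s s0 by (simp add: \<beta>)
  next
    case 2
    then show ?thesis using lip[of "s + s\<^sub>0 - L" "s' + s\<^sub>0 - L"] s s0 by (simp add: \<beta>)
  next
    case 3
    \<comment> \<open>The path wraps around, so the triangle inequality is applied at the common
      point \<open>\<gamma> L = \<gamma> 0\<close>.\<close>
    have "dist (\<beta> s) (\<beta> s') \<le> dist (\<gamma> (s + s\<^sub>0)) (\<gamma> L) + dist (\<gamma> 0) (\<gamma> (s' + s\<^sub>0 - L))"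
      using 3 L(2) dist_triangle[of "\<beta> s" "\<beta> s'" "\<gamma> L"] by (simp add: \<beta>)
    also have "\<dots> \<le> (L - (s + s\<^sub>0)) + ((s' + s\<^sub>0 - L) - 0)"
      using lip[of "s + s\<^sub>0" L] lip[of 0 "s' + s\<^sub>0 - L"] 3 s s0 by (intro add_mono) auto
    finally show ?thesis by simp
  qed
qed

text \<open>The rotated set is covered by translates of the parts of the original set in
  \<open>{s\<^sub>0..L}\<close> and \<open>{0..s\<^sub>0}\<close>. These parts could share only
  \<open>s\<^sub>0\<close>, which fails \<open>P\<close>, so their measures add up.\<close>

lemma emeasure_rotate_start_le:
  fixes \<gamma> :: "real \<Rightarrow> 'a" and P :: "'a \<Rightarrow> bool"
  assumes s0: "0 \<le> s\<^sub>0" "s\<^sub>0 < L" "\<not> P (\<gamma> s\<^sub>0)" and borel: "{s \<in> {0..L}. P (\<gamma> s)} \<in> sets borel"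
  shows "emeasure lborel {s \<in> {0<..<L}. P (rotate_start s\<^sub>0 L \<gamma> s)} \<le> emeasure lborel {s \<in> {0..L}. P (\<gamma> s)}"
proof -
  let ?S = "{s \<in> {0..L}. P (\<gamma> s)}"
  let ?A = "?S \<inter> {s\<^sub>0..L}" and ?B = "?S \<inter> {0..s\<^sub>0}"
  have shift: "emeasure lborel ((\<lambda>x. c + x) -` T) = emeasure lborel T" if "T \<in> sets borel" for c :: real and T
  proof -
    have "emeasure lborel T = emeasure (distr lborel borel ((+) c)) T" by (simp add: lborel_distr_plus)
    also have "\<dots> = emeasure lborel ((\<lambda>x. c + x) -` T)" using that by (subst emeasure_distr) auto
    finally show ?thesis by simp
  qed
  have AB: "?A \<in> sets borel" "?B \<in> sets borel" using borel by auto
  have borel_vimage: "(\<lambda>x. c + x) -` T \<in> sets borel" if "T \<in> sets borel" for c :: real and T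
    using that by (intro measurable_sets_borel[of "\<lambda>x. c + x" borel]) simp_all
  note vimage = borel_vimage[OF AB(1)] borel_vimage[OF AB(2)]
  have "{s \<in> {0<..<L}. P (rotate_start s\<^sub>0 L \<gamma> s)} \<subseteq> (\<lambda>x. s\<^sub>0 + x) -` ?A \<union> (\<lambda>x. (s\<^sub>0 - L) + x) -` ?B"
  proof
    fix s assume "s \<in> {s \<in> {0<..<L}. P (rotate_start s\<^sub>0 L \<gamma> s)}"
    then have s: "0 < s" "s < L" "P (rotate_start s\<^sub>0 L \<gamma> s)" by auto
    show "s \<in> (\<lambda>x. s\<^sub>0 + x) -` ?A \<union> (\<lambda>x. (s\<^sub>0 - L) + x) -` ?B"
    proof (cases "s + s\<^sub>0 \<le> L")
      case True
      then have "s\<^sub>0 + s \<in> ?A" using s s0 by (simp add: rotate_start_def add.commute)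
      then show ?thesis by blast
    next
      case False
      then have "s + s\<^sub>0 - L \<in> ?B" using s s0 by (simp add: rotate_start_def)
      also have "s + s\<^sub>0 - L = s\<^sub>0 - L + s" by simp
      finally have "s\<^sub>0 - L + s \<in> ?B" .
      then show ?thesis by blast
    qed
  qed
  then have "emeasure lborel {s \<in> {0<..<L}. P (rotate_start s\<^sub>0 L \<gamma> s)}
      \<le> emeasure lborel ((\<lambda>x. s\<^sub>0 + x) -` ?A \<union> (\<lambda>x. (s\<^sub>0 - L) + x) -` ?B)"
    by (rule emeasure_mono) (simp only: sets_lborel sets.Un vimage)
  also have "\<dots> \<le> emeasure lborel ((\<lambda>x. s\<^sub>0 + x) -` ?A) + emeasure lborel ((\<lambda>x. (s\<^sub>0 - L) + x) -` ?B)"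
    by (rule emeasure_subadditive) (simp_all only: sets_lborel vimage)
  also have "\<dots> = emeasure lborel ?A + emeasure lborel ?B"
    using AB by (simp only: shift)
  also have "\<dots> = emeasure lborel (?A \<union> ?B)"
  proof (rule plus_emeasure)
    show "?A \<inter> ?B = {}" using s0(3) by (auto dest: order_antisym)
  qed (simp_all only: sets_lborel AB)
  also have "?A \<union> ?B = ?S" using s0 by auto
  finally show ?thesis .
qed

text \<open>The cap over each component of the part of the curve outside the disc of radius \<open>t\<close> is
  compared with the whole part of the curve inside the disc.\<close>
lemma inner_length_area:
  fixes K :: "(real^2) set" and \<gamma> :: "real \<Rightarrow> real^2"
  assumes K: "symmetric_body K" and \<gamma>: "arc_length_parametrization \<gamma> L (frontier K)"
  shows "measure lborel {s \<in> {0..L}. norm (\<gamma> s) < t} * measure lborel K \<le> L * measure lborel (K \<inter> cball 0 t)"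
proof (cases "\<exists>s\<in>{0..L}. norm (\<gamma> s) < t")
  case False
  then have "{s \<in> {0..L}. norm (\<gamma> s) < t} = {}" by auto
  moreover have "0 < L" using \<gamma> by (simp add: arc_length_parametrization_def)
  ultimately show ?thesis by (simp del: Collect_empty_eq)
next
  case True
  interpret symmetric_body K by fact
  have L: "0 < L" "\<gamma> L = \<gamma> 0" "inj_on \<gamma> {0..<L}" "\<gamma> ` {0..L} = frontier K" "continuous_on {0..L} \<gamma>"
    and len: "\<And>p q. 0 \<le> p \<Longrightarrow> p \<le> q \<Longrightarrow> q \<le> L \<Longrightarrow> curve_length \<gamma> p q = ennreal (q - p)"
    using \<gamma> by (auto simp: arc_length_parametrization_def)
  obtain s0 where s0: "0 \<le> s0" "s0 < L" "norm (\<gamma> s0) < t"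
  proof -
    obtain s where "s \<in> {0..L}" "norm (\<gamma> s) < t" using True by blast
    then show thesis using that[of s] that[of 0] L(1,2) by (cases "s = L") auto
  qed
  define \<beta> where "\<beta> = rotate_start s0 L \<gamma>"
  note \<beta> = rotate_start_closed_curve[OF \<gamma> s0(1,2), folded \<beta>_def]
  have cont_\<beta>: "continuous_on {0..L} \<beta>"
  proof (rule lipschitz_on_continuous_on[where L = 1])
    show "1-lipschitz_on {0..L} \<beta>"
    proof (rule lipschitz_onI)
      fix x y assume "x \<in> {0..L}" "y \<in> {0..L}"
      then show "dist (\<beta> x) (\<beta> y) \<le> 1 * dist x y"
        using \<beta>(5)[of x y] \<beta>(5)[of y x] by (cases "x \<le> y") (auto simp: dist_real_def dist_commute)
    qed simp
  qed
  let ?U = "{s \<in> {0<..<L}. t < norm (\<beta> s)}" and ?in = "{s \<in> {0..L}. norm (\<gamma> s) < t}"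
    and ?out = "{s \<in> {0..L}. t < norm (\<gamma> s)}"
  define \<alpha> \<kappa> where "\<alpha> = measure lborel ?in" and "\<kappa> = measure lborel (K \<inter> cball 0 t)"
  have "open ({0<..<L} \<inter> \<beta> -` {z. t < norm z})"
    using cont_\<beta> by (intro continuous_open_preimage open_Collect_less continuous_intros) (auto intro: continuous_on_subset)
  moreover have "{0<..<L} \<inter> \<beta> -` {z. t < norm z} = ?U" by auto
  ultimately have "open ?U" by simp
  have "\<exists>B. compact B \<and>
      (\<forall>s\<in>C. \<forall>r. 0 \<le> r \<longrightarrow> r \<le> 1 \<longrightarrow> t < norm (r *\<^sub>R \<beta> s) \<longrightarrow> r *\<^sub>R \<beta> s \<in> B) \<and>
      \<alpha> * measure lborel B \<le> \<kappa> * measure lborel C" if C: "C \<in> components ?U" for C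
  proof -
    have "\<beta> ` {0..L} \<subseteq> frontier K" "\<gamma> ` {0..L} \<subseteq> frontier K" "norm (\<beta> 0) < t"
      using \<beta>(1,4) L(4) s0 by auto
    note sub = this
    obtain B where "compact B"
      "\<And>s r. s \<in> C \<Longrightarrow> 0 \<le> r \<Longrightarrow> r \<le> 1 \<Longrightarrow> t < norm (r *\<^sub>R \<beta> s) \<Longrightarrow> r *\<^sub>R \<beta> s \<in> B"
      "\<alpha> * measure lborel B \<le> \<kappa> * measure lborel C"
      unfolding \<alpha>_def \<kappa>_def
      using outer_component_box[OF K \<beta>(5) cont_\<beta> \<beta>(2,3) sub(1,3) L(5,3) sub(2) len C] by blast
    then show ?thesis by blast
  qed
  then have "\<forall>C\<in>components ?U. \<exists>B. compact B \<and>
      (\<forall>s\<in>C. \<forall>r. 0 \<le> r \<longrightarrow> r \<le> 1 \<longrightarrow> t < norm (r *\<^sub>R \<beta> s) \<longrightarrow> r *\<^sub>R \<beta> s \<in> B) \<and>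
      \<alpha> * measure lborel B \<le> \<kappa> * measure lborel C" by blast
  from bchoice[OF this] obtain B where "\<forall>C\<in>components ?U. compact (B C) \<and>
      (\<forall>s\<in>C. \<forall>r. 0 \<le> r \<longrightarrow> r \<le> 1 \<longrightarrow> t < norm (r *\<^sub>R \<beta> s) \<longrightarrow> r *\<^sub>R \<beta> s \<in> B C) \<and>
      \<alpha> * measure lborel (B C) \<le> \<kappa> * measure lborel C" by blast
  then have B: "\<And>C. C \<in> components ?U \<Longrightarrow> compact (B C)"
    "\<And>C s r. C \<in> components ?U \<Longrightarrow> s \<in> C \<Longrightarrow> 0 \<le> r \<Longrightarrow> r \<le> 1 \<Longrightarrow> t < norm (r *\<^sub>R \<beta> s) \<Longrightarrow> r *\<^sub>R \<beta> s \<in> B C"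
    "\<And>C. C \<in> components ?U \<Longrightarrow> \<alpha> * measure lborel (B C) \<le> \<kappa> * measure lborel C"
    by blast+
  \<comment> \<open>A point of \<open>K\<close> outside the disc is \<open>1 / r\<close> times a
    frontier point with \<open>r\<close> at least 1. That point is outside the disc too, so the
    given point belongs to the cap of its component.\<close>
  have cover: "K - cball 0 t \<subseteq> (\<Union>C\<in>components ?U. B C)"
  proof
    fix x assume x: "x \<in> K - cball 0 t"
    have "0 < t" using s0(3) norm_ge_zero[of "\<gamma> s0"] by linarith
    then have "x \<noteq> 0" using x by auto
    then obtain r where r: "1 \<le> r" "r *\<^sub>R x \<in> frontier K" using radial_frontier_point x by blast
    then obtain s where s: "s \<in> {0..L}" "\<beta> s = r *\<^sub>R x" using \<beta>(4) by (metis imageE)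
    have "t < norm x" using x by simp
    also have "norm x \<le> norm (\<beta> s)" using r(1) s(2) by (simp add: mult_le_cancel_right1)
    finally have "t < norm (\<beta> s)" .
    moreover have "norm (\<beta> 0) < t" "norm (\<beta> L) < t" using \<beta>(1,2) s0 by simp_all
    ultimately have "s \<noteq> 0" "s \<noteq> L" by auto
    then have "s \<in> ?U" using s(1) \<open>t < norm (\<beta> s)\<close> by auto
    then have "s \<in> \<Union>(components ?U)" by (simp only: Union_components)
    then obtain C where C: "C \<in> components ?U" "s \<in> C" by (rule UnionE)
    have "x = (1 / r) *\<^sub>R \<beta> s" using s(2) r(1) by simp
    then have "x \<in> B C" using B(2)[OF C, of "1 / r"] r(1) \<open>t < norm x\<close> by simp
    then show "x \<in> (\<Union>C\<in>components ?U. B C)" using C(1) by blast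
  qed
  have fin: "emeasure lborel T \<noteq> \<infinity>" if "bounded T" for T :: "'b::euclidean_space set"
    using emeasure_bounded_finite[OF that] by simp
  have em: "emeasure lborel T = ennreal (measure lborel T)" if "bounded T" for T :: "'b::euclidean_space set"
    using fin[OF that] by (simp add: emeasure_eq_ennreal_measure)
  have nonneg: "0 \<le> \<alpha>" "0 \<le> \<kappa>" by (simp_all add: \<alpha>_def \<kappa>_def)
  have bor_in: "?in \<in> sets borel" and bor_out: "?out \<in> sets borel"
    by (intro borel_Collect_continuous_on L(5) open_Collect_less continuous_intros; simp)+
  have cnt: "countable (components ?U)" by (rule countable_components_open) fact
  have borB: "B C \<in> sets lborel" if "C \<in> components ?U" for C
    using B(1)[OF that] by (simp add: borel_compact)
  have UB: "(\<Union>C\<in>components ?U. B C) \<in> sets lborel"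
    by (rule sets.countable_UN''[OF cnt borB])
  \<comment> \<open>The outer arcs may be infinitely many, so the summation over components is done
    in \<open>ennreal\<close>, as an integral over \<open>count_space\<close>.\<close>
  have "ennreal \<alpha> * emeasure lborel (K - cball 0 t) \<le> ennreal \<alpha> * emeasure lborel (\<Union>C\<in>components ?U. B C)"
    by (rule mult_left_mono[OF emeasure_mono[OF cover UB]]) simp
  also have "\<dots> \<le> ennreal \<alpha> * (\<integral>\<^sup>+C. emeasure lborel (B C) \<partial>count_space (components ?U))"
    by (rule mult_left_mono[OF emeasure_UN_countable_le[OF borB cnt]]) simp_all
  also have "\<dots> = (\<integral>\<^sup>+C. ennreal \<alpha> * emeasure lborel (B C) \<partial>count_space (components ?U))"
    by (intro nn_integral_cmult[symmetric]) simp
  also have "\<dots> \<le> (\<integral>\<^sup>+C. ennreal \<kappa> * emeasure lborel C \<partial>count_space (components ?U))"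
  proof (intro nn_integral_mono)
    fix C assume "C \<in> space (count_space (components ?U))"
    then have C: "C \<in> components ?U" by simp
    have "?U \<subseteq> {0..L}" by auto
    then have "C \<subseteq> {0..L}" using in_components_subset[OF C] by (rule subset_trans[rotated])
    then have "bounded C" by (rule bounded_subset[OF compact_imp_bounded[OF compact_Icc]])
    have "ennreal (\<alpha> * measure lborel (B C)) \<le> ennreal (\<kappa> * measure lborel C)"
      by (rule ennreal_leI[OF B(3)[OF C]])
    then show "ennreal \<alpha> * emeasure lborel (B C) \<le> ennreal \<kappa> * emeasure lborel C"
      unfolding em[OF compact_imp_bounded[OF B(1)[OF C]]] em[OF \<open>bounded C\<close>]
      by (simp only: ennreal_mult nonneg measure_nonneg)
  qed
  also have "\<dots> = ennreal \<kappa> * (\<integral>\<^sup>+C. emeasure lborel C \<partial>count_space (components ?U))"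
    by (intro nn_integral_cmult) simp
  also have "\<dots> = ennreal \<kappa> * emeasure lborel ?U"
    using emeasure_components[OF \<open>open ?U\<close>] by simp
  also have "\<dots> \<le> ennreal \<kappa> * emeasure lborel ?out"
    using emeasure_rotate_start_le[where P = "\<lambda>z. t < norm z", OF s0(1,2) _ bor_out] s0(3)
    by (intro mult_left_mono) (auto simp: \<beta>_def)
  finally have "ennreal \<alpha> * emeasure lborel (K - cball 0 t) \<le> ennreal \<kappa> * emeasure lborel ?out" .
  moreover have "bounded ?out" "bounded ?in" by (rule bounded_subset[of "{0..L}"]; auto)+
  moreover have "bounded (K - cball 0 t)" "bounded (K \<inter> cball 0 t)"
    using compact_imp_bounded[OF compact_K] by (auto intro: bounded_subset)
  ultimately have "ennreal (\<alpha> * measure lborel (K - cball 0 t)) \<le> ennreal (\<kappa> * measure lborel ?out)"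
    by (simp only: em ennreal_mult nonneg measure_nonneg)
  then have main: "\<alpha> * measure lborel (K - cball 0 t) \<le> \<kappa> * measure lborel ?out"
    by (simp add: ennreal_le_iff nonneg)
  have bK: "K \<in> sets borel" using compact_K by (rule borel_compact)
  have "measure lborel ((K \<inter> cball 0 t) \<union> (K - cball 0 t)) = \<kappa> + measure lborel (K - cball 0 t)"
    unfolding \<kappa>_def using fin \<open>bounded (K - cball 0 t)\<close> \<open>bounded (K \<inter> cball 0 t)\<close> bK
    by (intro measure_Union) auto
  also have "(K \<inter> cball 0 t) \<union> (K - cball 0 t) = K" by auto
  finally have mK: "measure lborel K = \<kappa> + measure lborel (K - cball 0 t)" .
  have "\<alpha> + measure lborel ?out = measure lborel (?in \<union> ?out)"
    unfolding \<alpha>_def using fin \<open>bounded ?out\<close> \<open>bounded ?in\<close> bor_in bor_out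
    by (intro measure_Union[symmetric]) auto
  also have "\<dots> \<le> measure lborel {0..L}"
  proof (rule measure_mono_fmeasurable)
    show "?in \<union> ?out \<in> sets lborel" by (simp only: sets_lborel sets.Un bor_in bor_out)
    show "{0..L} \<in> fmeasurable lborel" by (simp add: fmeasurable_def emeasure_lborel_Icc_eq)
  qed auto
  finally have "\<alpha> + measure lborel ?out \<le> L" using L(1) by simp
  \<comment> \<open>Adding \<open>\<alpha> * \<kappa>\<close> to both sides of \<open>main\<close>
    produces \<open>\<alpha> * measure lborel K\<close> on the left and the left side of this
    inequality on the right.\<close>
  then have "\<kappa> * (\<alpha> + measure lborel ?out) \<le> \<kappa> * L" by (intro mult_left_mono) (auto simp: \<kappa>_def)
  then show ?thesis using main unfolding \<alpha>_def[symmetric] \<kappa>_def[symmetric] mK by (simp add: algebra_simps)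
qed

section \<open>Moments of the distance to the centre\<close>

text \<open>The centre is interior as the midpoint of an interior point and its reflection.\<close>

lemma symmetric_body_translate:
  fixes K :: "'a::euclidean_space set"
  assumes "convex_body K" "centrally_symmetric_about c K"
  shows "symmetric_body ((\<lambda>x. - c + x) ` K)" (is "symmetric_body ?K")
proof
  have K: "convex K" "compact K" "interior K \<noteq> {}" using assms(1) by (auto simp: convex_body_def)
  show "convex ?K" by (rule convex_translation[OF K(1)])
  show "compact ?K" by (rule compact_translation[OF K(2)])
  show sym: "- x \<in> ?K" if x: "x \<in> ?K" for x
  proof -
    obtain y where y: "y \<in> K" "x = - c + y" using x by blast
    then have "2 *\<^sub>R c - y \<in> K" using assms(2) by (simp add: centrally_symmetric_about_def)
    then show ?thesis by (rule rev_image_eqI) (simp add: y scaleR_2)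
  qed
  have "uminus ` ?K = ?K" using sym by (force intro: image_eqI[of _ uminus "- x" for x])
  then have int: "uminus ` interior ?K = interior ?K" using interior_negations[of ?K] by simp
  obtain x where "x \<in> interior ?K" using K(3) unfolding interior_translation by blast
  moreover have "- x \<in> interior ?K" using calculation int by (metis imageI)
  ultimately have "(1/2) *\<^sub>R x + (1/2) *\<^sub>R (- x) \<in> interior ?K"
    using \<open>convex ?K\<close> by (intro convexD[OF convex_interior]) auto
  then show "0 \<in> interior ?K" by simp
qed

lemma arc_length_parametrization_translate:
  fixes \<gamma> :: "real \<Rightarrow> 'a::real_normed_vector"
  assumes "arc_length_parametrization \<gamma> L C"
  shows "arc_length_parametrization (\<lambda>s. c + \<gamma> s) L ((\<lambda>x. c + x) ` C)"
proof -
  have "curve_length (\<lambda>s. c + \<gamma> s) p q = curve_length \<gamma> p q" for p q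
    by (simp add: curve_length_def)
  then show ?thesis
    using assms by (auto simp: arc_length_parametrization_def inj_on_def intro!: continuous_intros)
qed

lemma measure_lborel_translation_compact:
  fixes S :: "'a::euclidean_space set"
  assumes "compact S"
  shows "measure lborel ((\<lambda>x. c + x) ` S) = measure lborel S"
proof -
  have "S \<in> sets borel" "(\<lambda>x. c + x) ` S \<in> sets borel"
    using assms by (auto intro!: borel_compact compact_translation)
  then show ?thesis using measure_translation[of c S] by (simp add: measure_completion)
qed

lemma inner_length_area_about:
  fixes K :: "(real^2) set" and \<gamma> :: "real \<Rightarrow> real^2"
  assumes K: "convex_body K" "centrally_symmetric_about c K"
    and \<gamma>: "arc_length_parametrization \<gamma> L (frontier K)"
  shows "measure lborel {s \<in> {0..L}. dist c (\<gamma> s) < t} * measure lborel K \<le> L * measure lborel (K \<inter> cball c t)"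
proof -
  let ?K = "(\<lambda>x. - c + x) ` K"
  have "arc_length_parametrization (\<lambda>s. - c + \<gamma> s) L (frontier ?K)"
    using arc_length_parametrization_translate[OF \<gamma>, of "- c"] by (simp only: frontier_translation)
  then have "measure lborel {s \<in> {0..L}. norm (- c + \<gamma> s) < t} * measure lborel ?K
      \<le> L * measure lborel (?K \<inter> cball 0 t)"
    by (rule inner_length_area[OF symmetric_body_translate[OF K]])
  moreover have "norm (- c + \<gamma> s) = dist c (\<gamma> s)" for s
    by (simp add: dist_norm norm_minus_commute)
  moreover have "?K \<inter> cball 0 t = (\<lambda>x. - c + x) ` (K \<inter> cball c t)"
    by (auto simp: dist_norm norm_minus_commute)
  moreover have "compact K" "compact (K \<inter> cball c t)"
    using K(1) by (auto simp: convex_body_def)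
  ultimately show ?thesis by (simp only: measure_lborel_translation_compact)
qed

lemma powr_less_iff:
  fixes x t n :: real
  assumes "0 \<le> x" "0 < t" "0 < n"
  shows "x powr n < t \<longleftrightarrow> x < t powr (1 / n)" "x powr n \<le> t \<longleftrightarrow> x \<le> t powr (1 / n)"
proof -
  have t: "t = (t powr (1 / n)) powr n" using assms by (simp add: powr_powr)
  show less: "x powr n < t \<longleftrightarrow> x < t powr (1 / n)"
    using assms powr_less_mono2[of n x "t powr (1 / n)"] powr_mono2[of n "t powr (1 / n)" x]
    by (subst t) (auto simp: not_less[symmetric])
  show "x powr n \<le> t \<longleftrightarrow> x \<le> t powr (1 / n)"
    using assms powr_less_mono2[of n "t powr (1 / n)" x] powr_mono2[of n x "t powr (1 / n)"]
    by (subst t) (auto simp: not_less[symmetric])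
qed

section \<open>Comparison of expectations through tail probabilities\<close>

context prob_space
begin

text \<open>Tonelli's theorem for the region under the graph of \<open>f\<close>, without and with
  its upper edge. Both forms are used, because the comparison of length and area sets an open disc
  against a closed one.\<close>

lemma nn_integral_layer_cake:
  fixes f :: "'a \<Rightarrow> real"
  assumes f[measurable]: "f \<in> borel_measurable M" and nonneg: "\<And>x. 0 \<le> f x"
  shows "(\<integral>\<^sup>+x. ennreal (f x) \<partial>M) = (\<integral>\<^sup>+t. indicator {0<..} t * emeasure M {x \<in> space M. t < f x} \<partial>lborel)"
    and "(\<integral>\<^sup>+x. ennreal (f x) \<partial>M) = (\<integral>\<^sup>+t. indicator {0<..} t * emeasure M {x \<in> space M. t \<le> f x} \<partial>lborel)"
proof -
  interpret P: pair_sigma_finite M lborel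
    by unfold_locales
  let ?A = "{z \<in> space (M \<Otimes>\<^sub>M lborel). 0 < snd z \<and> snd z < f (fst z)}"
  let ?B = "{z \<in> space (M \<Otimes>\<^sub>M lborel). 0 < snd z \<and> snd z \<le> f (fst z)}"
  have A: "?A \<in> sets (M \<Otimes>\<^sub>M lborel)" and B: "?B \<in> sets (M \<Otimes>\<^sub>M lborel)"
    by measurable
  have "(\<integral>\<^sup>+x. ennreal (f x) \<partial>M) = (\<integral>\<^sup>+x. emeasure lborel (Pair x -` ?A) \<partial>M)"
  proof (rule nn_integral_cong)
    fix x assume "x \<in> space M"
    then have "Pair x -` ?A = {0<..<f x}" by (auto simp: space_pair_measure)
    then show "ennreal (f x) = emeasure lborel (Pair x -` ?A)" using nonneg by simp
  qed
  also have "\<dots> = (\<integral>\<^sup>+t. emeasure M ((\<lambda>x. (x, t)) -` ?A) \<partial>lborel)"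
    using P.emeasure_pair_measure_alt2[OF A] lborel.emeasure_pair_measure_alt[OF A] by simp
  also have "\<dots> = (\<integral>\<^sup>+t. indicator {0<..} t * emeasure M {x \<in> space M. t < f x} \<partial>lborel)"
  proof (rule nn_integral_cong)
    fix t :: real
    have "(\<lambda>x. (x, t)) -` ?A = (if 0 < t then {x \<in> space M. t < f x} else {})"
      by (auto simp: space_pair_measure)
    then show "emeasure M ((\<lambda>x. (x, t)) -` ?A) = indicator {0<..} t * emeasure M {x \<in> space M. t < f x}"
      by simp
  qed
  finally show "(\<integral>\<^sup>+x. ennreal (f x) \<partial>M) = (\<integral>\<^sup>+t. indicator {0<..} t * emeasure M {x \<in> space M. t < f x} \<partial>lborel)" .
  have "(\<integral>\<^sup>+x. ennreal (f x) \<partial>M) = (\<integral>\<^sup>+x. emeasure lborel (Pair x -` ?B) \<partial>M)"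
  proof (rule nn_integral_cong)
    fix x assume "x \<in> space M"
    then have "Pair x -` ?B = {0<..f x}" by (auto simp: space_pair_measure)
    then show "ennreal (f x) = emeasure lborel (Pair x -` ?B)" using nonneg by simp
  qed
  also have "\<dots> = (\<integral>\<^sup>+t. emeasure M ((\<lambda>x. (x, t)) -` ?B) \<partial>lborel)"
    using P.emeasure_pair_measure_alt2[OF B] lborel.emeasure_pair_measure_alt[OF B] by simp
  also have "\<dots> = (\<integral>\<^sup>+t. indicator {0<..} t * emeasure M {x \<in> space M. t \<le> f x} \<partial>lborel)"
  proof (rule nn_integral_cong)
    fix t :: real
    have "(\<lambda>x. (x, t)) -` ?B = (if 0 < t then {x \<in> space M. t \<le> f x} else {})"
      by (auto simp: space_pair_measure)
    then show "emeasure M ((\<lambda>x. (x, t)) -` ?B) = indicator {0<..} t * emeasure M {x \<in> space M. t \<le> f x}"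
      by simp
  qed
  finally show "(\<integral>\<^sup>+x. ennreal (f x) \<partial>M) = (\<integral>\<^sup>+t. indicator {0<..} t * emeasure M {x \<in> space M. t \<le> f x} \<partial>lborel)" .
qed

text \<open>Integrating the comparison of tails gives the weak inequality; the gap
  \<open>\<delta>\<close> on the interval from \<open>t\<^sub>1\<close> to \<open>t\<^sub>2\<close>
  adds \<open>\<delta> * (t\<^sub>2 - t\<^sub>1)\<close>, which makes it strict.\<close>

lemma expectation_less_of_tails:
  fixes f g :: "'a \<Rightarrow> real"
  assumes f: "integrable M f" "\<And>x. 0 \<le> f x" and g: "integrable M g" "\<And>x. 0 \<le> g x"
    and le: "\<And>t. 0 < t \<Longrightarrow> prob {x \<in> space M. g x < t} \<le> prob {x \<in> space M. f x \<le> t}"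
    and gap: "0 < t\<^sub>1" "t\<^sub>1 < t\<^sub>2" "0 < \<delta>"
      "\<And>t. t\<^sub>1 < t \<Longrightarrow> t < t\<^sub>2 \<Longrightarrow> prob {x \<in> space M. g x < t} + \<delta> \<le> prob {x \<in> space M. f x \<le> t}"
  shows "expectation f < expectation g"
proof -
  have [measurable]: "f \<in> borel_measurable M" "g \<in> borel_measurable M" using f g by auto
  have mono: "indicator {0<..} t * emeasure M {x \<in> space M. t < f x} + ennreal \<delta> * indicator {t\<^sub>1<..<t\<^sub>2} t
      \<le> indicator {0<..} t * emeasure M {x \<in> space M. t \<le> g x}" for t
  proof (cases "0 < t")
    case True
    have "{x \<in> space M. t < f x} = space M - {x \<in> space M. f x \<le> t}" by auto
    then have F: "prob {x \<in> space M. t < f x} = 1 - prob {x \<in> space M. f x \<le> t}" by (simp add: prob_compl)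
    have "{x \<in> space M. t \<le> g x} = space M - {x \<in> space M. g x < t}" by auto
    then have G: "prob {x \<in> space M. t \<le> g x} = 1 - prob {x \<in> space M. g x < t}" by (simp add: prob_compl)
    have "prob {x \<in> space M. t < f x} + \<delta> * indicator {t\<^sub>1<..<t\<^sub>2} t \<le> prob {x \<in> space M. t \<le> g x}"
      using le[OF True] gap(4)[of t] by (auto simp: F G split: split_indicator)
    then have "ennreal (prob {x \<in> space M. t < f x} + \<delta> * indicator {t\<^sub>1<..<t\<^sub>2} t) \<le> ennreal (prob {x \<in> space M. t \<le> g x})"
      by (rule ennreal_leI)
    then show ?thesis
      using True gap(3) by (auto simp: emeasure_eq_measure ennreal_plus split: split_indicator)
  next
    case False
    then show ?thesis using gap(1) by (auto split: split_indicator)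
  qed
  have "(\<integral>\<^sup>+x. ennreal (f x) \<partial>M) + ennreal (\<delta> * (t\<^sub>2 - t\<^sub>1))
      = (\<integral>\<^sup>+t. indicator {0<..} t * emeasure M {x \<in> space M. t < f x} \<partial>lborel)
        + (\<integral>\<^sup>+t. ennreal \<delta> * indicator {t\<^sub>1<..<t\<^sub>2} t \<partial>lborel)"
    using gap f(2) by (simp add: nn_integral_layer_cake(1) nn_integral_cmult_indicator ennreal_mult)
  also have "\<dots> = (\<integral>\<^sup>+t. indicator {0<..} t * emeasure M {x \<in> space M. t < f x}
      + ennreal \<delta> * indicator {t\<^sub>1<..<t\<^sub>2} t \<partial>lborel)"
    by (intro nn_integral_add[symmetric]) auto
  also have "\<dots> \<le> (\<integral>\<^sup>+t. indicator {0<..} t * emeasure M {x \<in> space M. t \<le> g x} \<partial>lborel)"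
    by (intro nn_integral_mono mono)
  also have "\<dots> = (\<integral>\<^sup>+x. ennreal (g x) \<partial>M)"
    using g(2) by (simp add: nn_integral_layer_cake(2))
  finally have "ennreal (expectation f) + ennreal (\<delta> * (t\<^sub>2 - t\<^sub>1)) \<le> ennreal (expectation g)"
    using f g by (simp add: nn_integral_eq_integral)
  moreover have "0 \<le> expectation f" "0 \<le> expectation g" "0 < \<delta> * (t\<^sub>2 - t\<^sub>1)"
    using f(2) g(2) gap by auto
  ultimately have "expectation f + \<delta> * (t\<^sub>2 - t\<^sub>1) \<le> expectation g"
    by (simp add: ennreal_plus[symmetric] ennreal_le_iff del: ennreal_plus)
  with \<open>0 < \<delta> * (t\<^sub>2 - t\<^sub>1)\<close> show ?thesis by linarith
qed

end

section \<open>Laws of the two random points and the final comparison\<close>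

lemma (in prob_space) prob_uniform_wrt_lebesgue:
  assumes X: "uniform_wrt_lebesgue M X K" and K: "compact K" "0 < measure lborel K" and S: "S \<in> sets borel"
  shows "prob {\<omega> \<in> space M. X \<omega> \<in> S} = measure lborel (K \<inter> S) / measure lborel K"
proof -
  have X': "X \<in> borel_measurable M" "distr M borel X = uniform_measure lborel K"
    using X by (auto simp: uniform_wrt_lebesgue_def)
  have "prob {\<omega> \<in> space M. X \<omega> \<in> S} = measure (distr M borel X) S"
    using X'(1) S by (simp add: measure_distr vimage_def Int_def conj_commute)
  also have "\<dots> = measure lborel (K \<inter> S) / measure lborel K"
    unfolding X'(2) using K S by (intro measure_uniform_measure) (auto simp: measure_def borel_compact)
  finally show ?thesis .
qed

text \<open>Extracts from the law of \<open>Y\<close> a parametrization defining it. The arc length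
  measure is the image of Lebesgue measure on \<open>{0..L}\<close> and gives \<open>C\<close> the
  mass \<open>L\<close>, so normalising it divides by \<open>L\<close>.\<close>

lemma (in prob_space) prob_uniform_wrt_arc_length:
  assumes Y: "uniform_wrt_arc_length M Y C" and C: "C \<in> sets borel"
  shows "\<exists>\<gamma> L. arc_length_parametrization \<gamma> L C \<and>
    (\<forall>S\<in>sets borel. prob {\<omega> \<in> space M. Y \<omega> \<in> S} = measure lborel {s \<in> {0..L}. \<gamma> s \<in> S} / L)"
proof -
  obtain \<gamma> L where Y': "Y \<in> borel_measurable M" and \<gamma>: "arc_length_parametrization \<gamma> L C"
    and distr: "distr M borel Y = uniform_measure (distr (restrict_space lborel {0..L}) borel \<gamma>) C"
    using Y unfolding uniform_wrt_arc_length_def arc_length_measure_on_def by blast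
  let ?\<sigma> = "distr (restrict_space lborel {0..L}) borel \<gamma>"
  have L: "0 < L" "continuous_on {0..L} \<gamma>" "\<gamma> ` {0..L} = C"
    using \<gamma> by (auto simp: arc_length_parametrization_def)
  have meas: "\<gamma> \<in> borel_measurable (restrict_space lborel {0..L})"
    using borel_measurable_continuous_on_restrict[OF L(2)]
    by (simp cong: measurable_cong_sets sets_restrict_space_cong)
  have \<sigma>: "emeasure ?\<sigma> S = emeasure lborel {s \<in> {0..L}. \<gamma> s \<in> S}" if "S \<in> sets borel" for S
  proof -
    have "emeasure ?\<sigma> S = emeasure (restrict_space lborel {0..L}) (\<gamma> -` S \<inter> space (restrict_space lborel {0..L}))"
      using meas that by (rule emeasure_distr)
    also have "\<dots> = emeasure lborel (\<gamma> -` S \<inter> {0..L})"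
      by (subst emeasure_restrict_space) (auto simp: space_restrict_space)
    also have "\<gamma> -` S \<inter> {0..L} = {s \<in> {0..L}. \<gamma> s \<in> S}" by auto
    finally show ?thesis .
  qed
  have full: "{s \<in> {0..L}. \<gamma> s \<in> C \<inter> S} = {s \<in> {0..L}. \<gamma> s \<in> S}" for S
    using L(3) by auto
  have "{s \<in> {0..L}. \<gamma> s \<in> C} = {0..L}" using L(3) by auto
  then have \<sigma>C: "emeasure ?\<sigma> C = ennreal L" using \<sigma>[OF C] L(1) by simp
  have "prob {\<omega> \<in> space M. Y \<omega> \<in> S} = measure lborel {s \<in> {0..L}. \<gamma> s \<in> S} / L" if S: "S \<in> sets borel" for S
  proof -
    have "prob {\<omega> \<in> space M. Y \<omega> \<in> S} = measure (distr M borel Y) S"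
      using Y' S by (simp add: measure_distr vimage_def Int_def conj_commute)
    also have "\<dots> = measure ?\<sigma> (C \<inter> S) / measure ?\<sigma> C"
      unfolding distr using \<sigma>C L(1) C S by (intro measure_uniform_measure) auto
    also have "\<dots> = measure lborel {s \<in> {0..L}. \<gamma> s \<in> S} / L"
      using \<sigma>C L(1) \<sigma>[of "C \<inter> S"] C S unfolding full by (simp add: measure_def)
    finally show ?thesis .
  qed
  with \<gamma> show ?thesis by blast
qed

theorem corollary1:
  fixes K :: "(real ^ 2) set" and c :: "real ^ 2"
    and M :: "'w measure" and X Y :: "'w \<Rightarrow> real ^ 2" and n :: real
  assumes "convex_body K"
    and "centrally_symmetric_about c K"
    and "prob_space M"
    and "uniform_wrt_lebesgue M X K"
    and "uniform_wrt_arc_length M Y (frontier K)"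
    and "n > 0"
  shows "prob_space.expectation M (\<lambda>\<omega>. dist c (Y \<omega>) powr n)
       > prob_space.expectation M (\<lambda>\<omega>. dist c (X \<omega>) powr n)"
proof -
  interpret prob_space M by fact
  have K: "compact K" "interior K \<noteq> {}" using assms(1) by (auto simp: convex_body_def)
  have frontier_sub: "frontier K \<subseteq> K"
    using K(1) by (simp add: compact_imp_closed frontier_subset_eq)
  interpret sb: symmetric_body "(\<lambda>x. - c + x) ` K"
    by (rule symmetric_body_translate) fact+
  have "c \<in> interior K" using sb.zero_interior unfolding interior_translation by auto
  \<comment> \<open>No boundary point is closer than \<open>\<rho>\<close> to \<open>c\<close>,
    whereas \<open>X\<close> comes arbitrarily close to \<open>c\<close> with positive probability;
    this yields strictness.\<close>
  then obtain \<rho> where \<rho>: "0 < \<rho>" "ball c \<rho> \<subseteq> interior K"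
    using open_contains_ball[of "interior K"] by auto
  have [measurable]: "X \<in> borel_measurable M" "Y \<in> borel_measurable M"
    using assms(4,5) by (auto simp: uniform_wrt_lebesgue_def uniform_wrt_arc_length_def)
  have pos: "0 < measure lborel (K \<inter> cball c r)" if "0 < r" for r
  proof -
    have "0 < measure lborel (ball c (min r \<rho>))" using that \<rho>(1) by (simp add: content_ball_pos)
    also have "\<dots> \<le> measure lborel (K \<inter> cball c r)"
    proof (rule measure_mono_fmeasurable)
      show "ball c (min r \<rho>) \<subseteq> K \<inter> cball c r" using \<rho>(2) interior_subset by fastforce
      show "K \<inter> cball c r \<in> fmeasurable lborel" using K(1) by (intro fmeasurable_compact compact_Int) auto
    qed simp
    finally show ?thesis .
  qed
  have "0 < measure lborel (K \<inter> cball c 1)" by (rule pos) simp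
  also have "\<dots> \<le> measure lborel K"
    using K(1) by (intro measure_mono_fmeasurable fmeasurable_compact) (auto intro: borel_compact)
  finally have mK: "0 < measure lborel K" .
  note prob_X = prob_uniform_wrt_lebesgue[OF assms(4) K(1) mK]
  obtain \<gamma> L where \<gamma>: "arc_length_parametrization \<gamma> L (frontier K)"
    and prob_Y: "\<And>S. S \<in> sets borel \<Longrightarrow> prob {\<omega> \<in> space M. Y \<omega> \<in> S} = measure lborel {s \<in> {0..L}. \<gamma> s \<in> S} / L"
    using prob_uniform_wrt_arc_length[OF assms(5) borel_closed[OF frontier_closed]] by blast
  have L: "0 < L" "\<gamma> ` {0..L} = frontier K" using \<gamma> by (auto simp: arc_length_parametrization_def)
  have dist_X: "prob {\<omega> \<in> space M. dist c (X \<omega>) \<le> r} = measure lborel (K \<inter> cball c r) / measure lborel K" for r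
    using prob_X[of "cball c r"] by simp
  have dist_Y: "prob {\<omega> \<in> space M. dist c (Y \<omega>) < r} = measure lborel {s \<in> {0..L}. dist c (\<gamma> s) < r} / L" for r
    using prob_Y[of "ball c r"] by simp
  \<comment> \<open>Stochastic dominance: \<open>inner_length_area_about\<close> divided by
    \<open>L\<close> and by the area of \<open>K\<close>.\<close>
  have le: "prob {\<omega> \<in> space M. dist c (Y \<omega>) < r} \<le> prob {\<omega> \<in> space M. dist c (X \<omega>) \<le> r}" for r
    unfolding dist_X dist_Y
    using inner_length_area_about[OF assms(1,2) \<gamma>, of r] L(1) mK by (simp add: field_simps)
  have zero: "prob {\<omega> \<in> space M. dist c (Y \<omega>) < r} = 0" if "r \<le> \<rho>" for r
  proof -
    have "\<not> dist c (\<gamma> s) < r" if "s \<in> {0..L}" for s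
    proof -
      have "\<gamma> s \<in> frontier K" using L(2) that by auto
      then show ?thesis using \<rho>(2) \<open>r \<le> \<rho>\<close> by (force simp: frontier_def)
    qed
    then have "{s \<in> {0..L}. dist c (\<gamma> s) < r} = {}" by blast
    then show ?thesis unfolding dist_Y by (simp only: measure_empty div_0)
  qed
  have X_K: "AE \<omega> in M. X \<omega> \<in> K"
  proof -
    have "prob {\<omega> \<in> space M. X \<omega> \<in> K} = 1" using K(1) mK by (subst prob_X) (simp_all add: borel_compact)
    then show ?thesis by (auto dest: AE_prob_1)
  qed
  have Y_K: "AE \<omega> in M. Y \<omega> \<in> K"
  proof -
    have "{s \<in> {0..L}. \<gamma> s \<in> K} = {0..L}" using L(2) frontier_sub by auto
    then have "prob {\<omega> \<in> space M. Y \<omega> \<in> K} = 1" using K(1) L(1) by (subst prob_Y) (simp_all add: borel_compact)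
    then show ?thesis by (auto dest: AE_prob_1)
  qed
  obtain R where R: "\<And>x. x \<in> K \<Longrightarrow> dist c x \<le> R"
    using compact_imp_bounded[OF K(1)] unfolding bounded_any_center[where a = c] by blast
  have "integrable M (\<lambda>\<omega>. dist c (Z \<omega>) powr n)"
    if [measurable]: "Z \<in> borel_measurable M" and Z: "AE \<omega> in M. Z \<omega> \<in> K" for Z
  proof (rule integrable_const_bound[where B = "R powr n"])
    show "AE \<omega> in M. norm (dist c (Z \<omega>) powr n) \<le> R powr n"
      using Z by eventually_elim (use R \<open>n > 0\<close> in \<open>auto intro: powr_mono2\<close>)
  qed measurable
  then have int: "integrable M (\<lambda>\<omega>. dist c (X \<omega>) powr n)" "integrable M (\<lambda>\<omega>. dist c (Y \<omega>) powr n)"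
    using X_K Y_K by simp_all
  \<comment> \<open>For radii between \<open>\<rho> / 2\<close> and \<open>\<rho>\<close> the tail
    of \<open>Y\<close> vanishes, while that of \<open>X\<close> is at least the probability of the
    disc of radius \<open>\<rho> / 2\<close>. The thresholds are the \<open>n\<close>-th powers of
    these radii.\<close>
  show ?thesis
  proof (rule expectation_less_of_tails[OF int(1) _ int(2), where t\<^sub>1 = "(\<rho> / 2) powr n" and t\<^sub>2 = "\<rho> powr n"
        and \<delta> = "prob {\<omega> \<in> space M. dist c (X \<omega>) \<le> \<rho> / 2}"])
    show "prob {\<omega> \<in> space M. dist c (Y \<omega>) powr n < t} \<le> prob {\<omega> \<in> space M. dist c (X \<omega>) powr n \<le> t}"
      if "0 < t" for t
      using le[of "t powr (1 / n)"] that \<open>n > 0\<close> by (simp add: powr_less_iff)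
    show "0 < (\<rho> / 2) powr n" "(\<rho> / 2) powr n < \<rho> powr n"
      using \<rho>(1) \<open>n > 0\<close> by (auto intro: powr_less_mono2)
    show "0 < prob {\<omega> \<in> space M. dist c (X \<omega>) \<le> \<rho> / 2}"
      unfolding dist_X using pos[of "\<rho> / 2"] \<rho>(1) mK by simp
    fix t assume t: "(\<rho> / 2) powr n < t" "t < \<rho> powr n"
    then have "0 < t" by (meson less_trans powr_ge_zero order_le_less_trans)
    have "t powr (1 / n) \<le> \<rho>"
    proof -
      have "t powr (1 / n) \<le> (\<rho> powr n) powr (1 / n)" using t \<open>0 < t\<close> \<open>n > 0\<close> by (intro powr_mono2) auto
      then show ?thesis using \<rho>(1) \<open>n > 0\<close> by (simp add: powr_powr)
    qed
    then have "prob {\<omega> \<in> space M. dist c (Y \<omega>) powr n < t} = 0"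
      using zero[of "t powr (1 / n)"] \<open>0 < t\<close> \<open>n > 0\<close> by (simp add: powr_less_iff)
    moreover have "prob {\<omega> \<in> space M. dist c (X \<omega>) \<le> \<rho> / 2} \<le> prob {\<omega> \<in> space M. dist c (X \<omega>) powr n \<le> t}"
    proof (rule finite_measure_mono)
      show "{\<omega> \<in> space M. dist c (X \<omega>) \<le> \<rho> / 2} \<subseteq> {\<omega> \<in> space M. dist c (X \<omega>) powr n \<le> t}"
      proof
        fix \<omega> assume \<omega>: "\<omega> \<in> {\<omega> \<in> space M. dist c (X \<omega>) \<le> \<rho> / 2}"
        then have "dist c (X \<omega>) powr n \<le> (\<rho> / 2) powr n" using \<open>n > 0\<close> by (intro powr_mono2) auto
        then show "\<omega> \<in> {\<omega> \<in> space M. dist c (X \<omega>) powr n \<le> t}" using t \<omega> by auto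
      qed
    qed measurable
    ultimately show "prob {\<omega> \<in> space M. dist c (Y \<omega>) powr n < t} + prob {\<omega> \<in> space M. dist c (X \<omega>) \<le> \<rho> / 2}
        \<le> prob {\<omega> \<in> space M. dist c (X \<omega>) powr n \<le> t}" by simp
  qed auto
qed

end
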